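(* Let $(T_n)_{n\ge1}$ be a positively divergent perturbed random walk and $p>0$. Then the following assertions are equivalent: (1) $\mathbb{E}\rho(x)^p<\infty$ for some/all $x\in\mathbb{R}$; (2) $\mathbb{E}\rho^*(y)^p<\infty$ for some/all $y\ge0$, and $\mathbb{E}J_+(\eta^-)^{p+1}<\infty$; (3) $\mathbb{E}J_+(\xi^-)^{p+1}<\infty$ and $\mathbb{E}J_+(\eta^-)^{p+1}<\infty$.
   Context: Let $(\xi,\eta),(\xi_1,\eta_1),(\xi_2,\eta_2),\ldots$ be i.i.d. $\mathbb{R}^2$-valued random vectors; no condition is imposed on the dependence between $\xi$ and $\eta$. Put $S_0:=0$, $S_n:=\xi_1+\cdots+\xi_n$ for $n\in\mathbb{N}=\{1,2,\ldots\}$, and $T_n:=S_{n-1}+\eta_n$ for $n\in\mathbb{N}$; $(T_n)_{n\ge1}$ is called a perturbed random walk. Standing assumption: $\mathbb{P}\{\xi=0\}<1$ and $\mathbb{P}\{\eta=0\}<1$. The perturbed random walk is called positively divergent if $\lim_{n\to\infty}T_n=\infty$ a.s. For $x\in\mathbb{R}$, $\rho(x):=\sup\{n\in\mathbb{N}:T_n\le x\}$ and $\rho^*(x):=\sup\{n\in\mathbb{N}_0:S_n\le x\}$, where $\mathbb{N}_0=\{0,1,2,\ldots\}$ and $\sup\emptyset:=0$. Write $z^+:=\max(z,0)$, $z^-:=\max(-z,0)$. For $x>0$ let $A_+(x):=\int_0^x\mathbb{P}\{\xi>y\}\,dy=\mathbb{E}\min(\xi^+,x)$ and $J_+(x):=x/A_+(x)$,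 and let $J_+(0):=1/\mathbb{P}\{\xi>0\}$ (these are well defined whenever $\mathbb{P}\{\xi>0\}>0$, which is the case for a positively divergent perturbed random walk). $J_+(\cdot)^{p+1}$ denotes the $(p+1)$st power of $J_+(\cdot)$ (inside the expectation), and similarly for $\rho(x)^p$, $\rho^*(y)^p$. An assertion "for some/all $x$" in a list of equivalent assertions means that both the version with "for some $x$" and the version with "for all $x$" belong to the list of equivalent assertions. *)

theory Defs
  imports "HOL-Probability.Probability"
begin

text \<open>
  The pair with index 0 is the generic vector \<open>(\<xi>, \<eta>)\<close>; the walk is driven by the pairs with
  indices \<open>n \<ge> 1\<close> only. Nothing is assumed on the dependence between \<open>\<xi> n\<close> and \<open>\<eta> n\<close>.
\<close>
locale perturbed_random_walk = prob_space M
  for M :: "'a measure" and \<xi> \<eta> :: "nat \<Rightarrow> 'a \<Rightarrow> real" +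
  assumes indep: "indep_vars (\<lambda>_. borel) (\<lambda>n \<omega>. (\<xi> n \<omega>, \<eta> n \<omega>)) UNIV"
    and ident_distr:
      "\<And>n. distr M borel (\<lambda>\<omega>. (\<xi> n \<omega>, \<eta> n \<omega>)) = distr M borel (\<lambda>\<omega>. (\<xi> 0 \<omega>, \<eta> 0 \<omega>))"
    and xi_nondegenerate: "\<P>(\<omega> in M. \<xi> 0 \<omega> = 0) < 1"
    and eta_nondegenerate: "\<P>(\<omega> in M. \<eta> 0 \<omega> = 0) < 1"

definition walk :: "(nat \<Rightarrow> 'a \<Rightarrow> real) \<Rightarrow> nat \<Rightarrow> 'a \<Rightarrow> real" where
  "walk \<xi> n \<omega> = (\<Sum>k=1..n. \<xi> k \<omega>)"

text \<open>Only meant for \<open>n \<ge> 1\<close>; all uses below ignore the value at \<open>n = 0\<close>.\<close>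
definition perturbed_walk :: "(nat \<Rightarrow> 'a \<Rightarrow> real) \<Rightarrow> (nat \<Rightarrow> 'a \<Rightarrow> real) \<Rightarrow> nat \<Rightarrow> 'a \<Rightarrow> real" where
  "perturbed_walk \<xi> \<eta> n \<omega> = walk \<xi> (n - 1) \<omega> + \<eta> n \<omega>"

definition positively_divergent ::
    "'a measure \<Rightarrow> (nat \<Rightarrow> 'a \<Rightarrow> real) \<Rightarrow> (nat \<Rightarrow> 'a \<Rightarrow> real) \<Rightarrow> bool" where
  "positively_divergent M \<xi> \<eta> \<longleftrightarrow>
     (AE \<omega> in M. filterlim (\<lambda>n. perturbed_walk \<xi> \<eta> n \<omega>) at_top sequentially)"

text \<open>
  Last exit times with values in \<open>[0, \<infinity>]\<close>; the supremum of the empty set is 0 in \<^typ>\<open>ennreal\<close>.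
\<close>
definition last_exit ::
    "(nat \<Rightarrow> 'a \<Rightarrow> real) \<Rightarrow> (nat \<Rightarrow> 'a \<Rightarrow> real) \<Rightarrow> real \<Rightarrow> 'a \<Rightarrow> ennreal" where
  "last_exit \<xi> \<eta> x \<omega> = (SUP n\<in>{n. 1 \<le> n \<and> perturbed_walk \<xi> \<eta> n \<omega> \<le> x}. of_nat n)"

definition last_exit_walk :: "(nat \<Rightarrow> 'a \<Rightarrow> real) \<Rightarrow> real \<Rightarrow> 'a \<Rightarrow> ennreal" where
  "last_exit_walk \<xi> x \<omega> = (SUP n\<in>{n. walk \<xi> n \<omega> \<le> x}. of_nat n)"

text \<open>Real powers on \<open>[0, \<infinity>]\<close>, for positive exponents.\<close>
definition ennreal_powr :: "ennreal \<Rightarrow> real \<Rightarrow> ennreal" where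
  "ennreal_powr r p = (if r = \<infinity> then \<infinity> else ennreal (enn2real r powr p))"

definition A_plus :: "'a measure \<Rightarrow> ('a \<Rightarrow> real) \<Rightarrow> real \<Rightarrow> real" where
  "A_plus M X x = (LBINT y:{0..x}. \<P>(\<omega> in M. X \<omega> > y))"

text \<open>Only meant for \<open>x \<ge> 0\<close> and \<open>X\<close> positive with positive probability.\<close>
definition J_plus :: "'a measure \<Rightarrow> ('a \<Rightarrow> real) \<Rightarrow> real \<Rightarrow> real" where
  "J_plus M X x = (if x = 0 then 1 / \<P>(\<omega> in M. X \<omega> > 0) else x / A_plus M X x)"

end

theory Submission
  imports Defs
begin

text \<open>
  Positive divergence of \<open>T\<close> forces \<open>S\<^sub>n \<rightarrow> \<infinity>\<close>, because after any late time at which the walk is low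
  an independent perturbation keeps \<open>T\<close> low with positive probability. Since \<open>T = S\<close> when
  \<open>\<eta> = \<xi>\<close> (up to the value at 0), statements about \<open>\<rho>\<close> contain those about \<open>\<rho>\<^sup>*\<close>. Moments are
  expressed through dyadic sums of tail probabilities.

  Necessity: the positive steps alone stay below \<open>a\<close> up to time \<open>2 n\<close> with probability at least
  1/2 if \<open>J\<^sub>+ a \<ge> 4 n\<close>, so one of \<open>n\<close> perturbations below \<open>- a\<close> makes \<open>\<rho> \<ge> n\<close>, which yields
  \<open>n \<P>(J\<^sub>+(\<eta>\<^sup>-) \<ge> c n) \<le> C \<P>(\<rho> \<ge> n)\<close>.

  Sufficiency: if \<open>T\<close> is low at some time in \<open>[N, 2 N)\<close>, truncate all steps at the size \<open>b\<close> of the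
  largest downward jump. The truncated walk has drift of order \<open>A\<^sub>+ b\<close>, so an exponential maximal
  inequality bounds the probability by \<open>C N \<E> exp(- c N / J\<^sub>+(b))\<close>, which sums to a moment of
  order \<open>p + 1\<close> of \<open>J\<^sub>+(b)\<close>.
\<close>

section \<open>Dyadic sums\<close>

text \<open>Heuristically \<open>J\<^sub>+ b = b / A\<^sub>+ b\<close> counts the steps that the
  walk needs to climb to height \<open>b\<close>, since \<open>A\<^sub>+ b\<close> is the drift
  visible at scale \<open>b\<close> even when the mean is infinite. A downward jump of size
  \<open>b\<close> therefore keeps the walk low for about \<open>J\<^sub>+ b\<close> steps, and it
  may occur at any of about as many indices. This freedom is the origin of the exponent
  \<open>p + 1\<close>: a moment of order \<open>p\<close> weights a block at time \<open>N\<close>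
  with \<open>N powr p\<close>, and the index of the jump contributes one more factor
  \<open>N\<close>. The drift is the delicate point. At every large scale the negative part of a
  truncated step has to stay below the positive part by a fixed factor. If \<open>A\<^sub>+\<close>
  is bounded, this rests on a positive mean, which must be extracted from divergence alone. The two
  components of a pair may depend on each other, so independence is only ever used between whole
  pairs, and both components enter the size of a jump jointly.\<close>

lemma dyadic_bracket:
  fixes x :: real
  assumes "1 \<le> x"
  obtains k :: nat where "2 ^ k \<le> x" "x < 2 ^ Suc k"
proof -
  define n where "n = (LEAST n. x < 2 ^ n)"
  obtain n0 where "x < 2 ^ n0" using real_arch_pow[of 2 x] by auto
  then have n: "x < 2 ^ n" unfolding n_def by (rule LeastI)
  then have "n \<noteq> 0" using assms by (intro notI) auto
  then obtain k where k: "n = Suc k" by (cases n) auto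
  have "\<not> x < 2 ^ k" using not_less_Least[of k "\<lambda>n. x < 2 ^ n"] k n_def by auto
  then show thesis using that[of k] n k by simp
qed

lemma pow2_powr: "((2::real) ^ k) powr r = (2 powr r) ^ k"
proof -
  have "((2::real) ^ k) powr r = (2 powr real k) powr r" by (simp add: powr_realpow)
  also have "\<dots> = (2 powr r) powr real k" by (simp only: powr_powr mult.commute)
  finally show ?thesis by (simp add: powr_realpow)
qed

lemma sum_powers_le:
  fixes q :: real assumes "q > 1"
  shows "(\<Sum>k\<le>n. q ^ k) \<le> q / (q - 1) * q ^ n"
proof -
  have "(\<Sum>k\<le>n. q ^ k) = (q ^ Suc n - 1) / (q - 1)"
    using assms geometric_sum[of q "Suc n"] by (simp add: lessThan_Suc_atMost)
  also have "\<dots> \<le> q ^ Suc n / (q - 1)" using assms by (intro divide_right_mono) auto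
  finally show ?thesis by simp
qed

text \<open>A geometric sum is dominated by its last term, here the one with
  \<open>2 ^ n \<le> x < 2 ^ Suc n\<close>.\<close>

lemma dyadic_sum_le_powr:
  fixes x r :: real
  assumes "r > 0" "x \<ge> 0"
  shows "(\<Sum>k. ennreal ((2 ^ k) powr r) * indicator {k. 2 ^ k \<le> x} k)
       \<le> ennreal (2 powr r / (2 powr r - 1) * x powr r)"
proof (cases "x < 1")
  case True
  have "\<not> 2 ^ k \<le> x" for k :: nat using True one_le_power[of "2::real" k] by linarith
  then show ?thesis by (simp add: indicator_def)
next
  case False
  define q where "q = 2 powr r"
  have q: "q > 1" using assms by (simp add: q_def)
  obtain n where n: "2 ^ n \<le> x" "x < 2 ^ Suc n" using dyadic_bracket[of x] False by auto
  have "indicator {k. 2 ^ k \<le> x} k = (0::ennreal)" if "k \<notin> {..n}" for k :: nat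
  proof -
    have "2 ^ Suc n \<le> (2::real) ^ k" using that by (intro power_increasing) auto
    then show ?thesis using n by (auto simp: indicator_def)
  qed
  then have "(\<Sum>k. ennreal ((2 ^ k) powr r) * indicator {k. 2 ^ k \<le> x} k)
     = (\<Sum>k\<le>n. ennreal ((2 ^ k) powr r) * indicator {k. 2 ^ k \<le> x} k)"
    by (intro suminf_finite) auto
  also have "\<dots> \<le> (\<Sum>k\<le>n. ennreal (q ^ k))"
    by (intro sum_mono) (auto simp: indicator_def pow2_powr q_def)
  also have "\<dots> = ennreal (\<Sum>k\<le>n. q ^ k)" using q by (intro sum_ennreal) auto
  also have "\<dots> \<le> ennreal (q / (q - 1) * x powr r)"
  proof (rule ennreal_leI)
    have "(\<Sum>k\<le>n. q ^ k) \<le> q / (q - 1) * q ^ n" by (rule sum_powers_le[OF q])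
    also have "q ^ n \<le> x powr r"
      unfolding q_def pow2_powr[symmetric] using n assms by (intro powr_mono2) auto
    then have "q / (q - 1) * q ^ n \<le> q / (q - 1) * x powr r"
      using q by (intro mult_left_mono) auto
    finally show "(\<Sum>k\<le>n. q ^ k) \<le> q / (q - 1) * x powr r" .
  qed
  finally show ?thesis unfolding q_def .
qed

text \<open>The single term with \<open>c * 2 ^ k \<le> x < c * 2 ^ Suc k\<close> already suffices.
  The cut-off \<open>k0\<close> and the factor \<open>c\<close> are there because tail estimates
  will be available only for large \<open>k\<close> and at rescaled thresholds.\<close>

lemma powr_le_dyadic_sum:
  fixes x r c :: real
  assumes "r > 0" "c > 0" "x \<ge> 0"
  shows "ennreal (x powr r) \<le> ennreal ((c * 2 ^ k0) powr r)
    + (\<Sum>k. ennreal ((2 * c * 2 ^ k) powr r) * indicator {k. k0 \<le> k \<and> c * 2 ^ k \<le> x} k)"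
proof (cases "x < c * 2 ^ k0")
  case True
  then have "x powr r \<le> (c * 2 ^ k0) powr r" using assms by (intro powr_mono2) auto
  then show ?thesis by (intro add_increasing2 ennreal_leI) auto
next
  case False
  have "c * 1 \<le> c * 2 ^ k0" using assms by (intro mult_left_mono) auto
  then have "c \<le> x" using False by linarith
  then have "1 \<le> x / c" using assms by (simp add: field_simps)
  then obtain k where k: "2 ^ k \<le> x / c" "x / c < 2 ^ Suc k" using dyadic_bracket by blast
  have "x < c * 2 ^ Suc k" using k(2) assms by (simp add: field_simps)
  then have "c * 2 ^ k0 < c * 2 ^ Suc k" using False by linarith
  then have "2 ^ k0 < (2::real) ^ Suc k" using assms by simp
  then have "k0 < Suc k" by (rule power_less_imp_less_exp[rotated]) simp
  have "ennreal (x powr r) \<le> ennreal ((2 * c * 2 ^ k) powr r)"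
    using k assms by (intro ennreal_leI powr_mono2) (auto simp: field_simps)
  also have "\<dots> = ennreal ((2 * c * 2 ^ k) powr r) * indicator {k. k0 \<le> k \<and> c * 2 ^ k \<le> x} k"
    using k assms \<open>k0 < Suc k\<close> by (auto simp: indicator_def field_simps)
  also have "\<dots> = (\<Sum>i\<in>{k}. ennreal ((2 * c * 2 ^ i) powr r) * indicator {k. k0 \<le> k \<and> c * 2 ^ k \<le> x} i)"
    by (simp only: sum.insert finite.emptyI empty_iff sum.empty add_0_right not_False_eq_True)
  also have "\<dots> \<le> (\<Sum>k. ennreal ((2 * c * 2 ^ k) powr r) * indicator {k. k0 \<le> k \<and> c * 2 ^ k \<le> x} k)"
    by (intro sum_le_suminf) auto
  finally show ?thesis by (intro add_increasing) auto
qed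

lemma exp_minus_le_powr:
  fixes t a :: real assumes "t > 0" "a > 0"
  shows "exp (- t) \<le> (a / t) powr a"
proof -
  have "t / a \<le> exp (t / a)" using exp_ge_add_one_self[of "t/a"] by linarith
  then have "(t / a) powr a \<le> exp (t / a) powr a" using assms by (intro powr_mono2) auto
  also have "\<dots> = exp t" using assms by (simp add: powr_def)
  finally have "inverse (exp t) \<le> inverse ((t / a) powr a)" using assms by (intro le_imp_inverse_le) auto
  also have "\<dots> = (a / t) powr a" using assms by (simp add: powr_divide)
  finally show ?thesis by (simp add: exp_minus)
qed

text \<open>Scaling: if \<open>2 ^ n\<close> is the dyadic size of \<open>x\<close>, the terms up to
  \<open>n\<close> sum to the order of \<open>q ^ n \<le> x powr r\<close>, and the later ones are
  at most \<open>q ^ Suc n\<close> times a convergent series \<open>h\<close> that no longer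
  involves \<open>x\<close>.\<close>

lemma dyadic_exp_sum_le:
  fixes r c :: real
  assumes r: "r > 0" and c: "c > 0"
  shows "\<exists>C\<ge>0. \<forall>x\<ge>1. (\<Sum>j. ennreal ((2 ^ j) powr r * exp (- (c * 2 ^ j / x)))) \<le> ennreal (C * x powr r)"
proof -
  define q where "q = 2 powr r"
  have q: "q > 1" using r by (simp add: q_def)
  define h where "h = (\<lambda>i::nat. q ^ i * exp (- (c * 2 ^ i)))"
  have h0: "0 \<le> h i" for i using q by (simp add: h_def)
  have hsum: "summable h"
  proof (rule summable_comparison_test')
    show "summable (\<lambda>i. ((r + 1) / c) powr (r + 1) * (1/2::real) ^ i)"
      by (intro summable_mult summable_geometric) auto
    fix i :: nat
    \<comment> \<open>The exponent \<open>r + 1\<close> beats the weight \<open>q ^ i\<close> by a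
      factor \<open>2 ^ i\<close>, which leaves a geometric series.\<close>
    have "exp (- (c * 2 ^ i)) \<le> ((r + 1) / (c * 2 ^ i)) powr (r + 1)"
      using r c by (intro exp_minus_le_powr) auto
    also have "\<dots> = ((r + 1) / c) powr (r + 1) * ((1 / 2 ^ i) powr (r + 1))"
      using r c by (subst powr_mult[symmetric]) auto
    also have "(1 / (2::real) ^ i) powr (r + 1) = (1/2) ^ i / q ^ i"
      by (simp add: q_def pow2_powr[symmetric] powr_divide powr_add power_one_over)
    finally show "norm (h i) \<le> ((r + 1) / c) powr (r + 1) * (1/2::real) ^ i"
      using q h0[of i] unfolding h_def by (simp add: field_simps)
  qed
  define C where "C = q / (q - 1) + q * suminf h"
  have S0: "0 \<le> suminf h" by (intro suminf_nonneg hsum h0)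
  have C0: "C \<ge> 0" using q S0 by (simp add: C_def)
  moreover have "(\<Sum>j. ennreal ((2 ^ j) powr r * exp (- (c * 2 ^ j / x)))) \<le> ennreal (C * x powr r)"
    if x: "x \<ge> 1" for x
  proof -
    define f where "f = (\<lambda>j::nat. q ^ j * exp (- (c * 2 ^ j / x)))"
    obtain n where n: "2 ^ n \<le> x" "x < 2 ^ Suc n" using dyadic_bracket[OF x] by auto
    have f0: "0 \<le> f j" for j using q by (simp add: f_def)
    have fle: "f (i + Suc n) \<le> q ^ Suc n * h i" for i
    proof -
      have "c * 2 ^ i \<le> c * 2 ^ (i + Suc n) / x"
        using n x c by (simp add: field_simps power_add)
      then have "exp (- (c * 2 ^ (i + Suc n) / x)) \<le> exp (- (c * 2 ^ i))" by simp
      then have "q ^ (i + Suc n) * exp (- (c * 2 ^ (i + Suc n) / x)) \<le> q ^ (i + Suc n) * exp (- (c * 2 ^ i))"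
        using q by (intro mult_left_mono) auto
      then show ?thesis unfolding f_def h_def by (simp add: power_add mult_ac)
    qed
    have s1: "summable (\<lambda>i. f (i + Suc n))"
      by (rule summable_comparison_test'[OF summable_mult[OF hsum, of "q ^ Suc n"], of 0])
        (use fle f0 in auto)
    then have s: "summable f" by (simp only: summable_iff_shift)
    have qn: "q ^ n \<le> x powr r"
      unfolding q_def pow2_powr[symmetric] using n r by (intro powr_mono2) auto
    have "suminf f = (\<Sum>i. f (i + Suc n)) + sum f {..<Suc n}"
      by (rule suminf_split_initial_segment[OF s])
    also have "(\<Sum>i. f (i + Suc n)) \<le> (\<Sum>i. q ^ Suc n * h i)"
      by (intro suminf_le fle s1 summable_mult hsum)
    also have "\<dots> = q ^ n * (q * suminf h)" by (subst suminf_mult[OF hsum]) simp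
    also have "sum f {..<Suc n} \<le> (\<Sum>j\<le>n. q ^ j)"
      unfolding lessThan_Suc_atMost f_def
      using q c x by (intro sum_mono mult_left_le) auto
    also have "\<dots> \<le> q / (q - 1) * q ^ n" by (rule sum_powers_le[OF q])
    finally have "suminf f \<le> q ^ n * C" by (simp add: C_def algebra_simps)
    also have "\<dots> \<le> x powr r * C" using qn C0 by (intro mult_right_mono) auto
    finally have le: "suminf f \<le> C * x powr r" by (simp add: mult.commute)
    have "(\<Sum>j. ennreal ((2 ^ j) powr r * exp (- (c * 2 ^ j / x)))) = (\<Sum>j. ennreal (f j))"
      by (simp add: f_def q_def pow2_powr)
    also have "\<dots> = ennreal (suminf f)" using s f0 by (intro suminf_ennreal2) auto
    finally show ?thesis using le by (simp add: ennreal_leI)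
  qed
  ultimately show ?thesis by blast
qed

section \<open>Truncated means\<close>

context prob_space
begin

text \<open>Layer-cake formula: Fubini for the indicator of \<open>0 \<le> y \<le> x\<close> and
  \<open>y < U \<omega>\<close>, whose section in \<open>y\<close> has length
  \<open>min (max (U \<omega>) 0) x\<close>.\<close>

lemma A_plus_eq_expectation:
  assumes [measurable]: "U \<in> borel_measurable M" and x: "0 \<le> x"
  shows "A_plus M U x = expectation (\<lambda>\<omega>. min (max (U \<omega>) 0) x)"
proof -
  interpret P: pair_sigma_finite M "lborel :: real measure"
    by (intro pair_sigma_finite.intro) unfold_locales
  have "ennreal (A_plus M U x) = (\<integral>\<^sup>+y. ennreal (indicator {0..x} y * prob {\<omega>\<in>space M. U \<omega> > y}) \<partial>lborel)"
    unfolding A_plus_def set_lebesgue_integral_def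
  proof (subst nn_integral_eq_integral)
    have m[measurable]: "(\<lambda>y. prob {\<omega>\<in>space M. U \<omega> > y}) \<in> borel_measurable lborel"
    proof -
      have "(\<lambda>y. \<integral>\<omega>. indicat_real {\<omega>\<in>space M. U \<omega> > y} \<omega> \<partial>M) \<in> borel_measurable lborel"
      proof -
        have "(\<lambda>y. \<integral>\<omega>. (if U \<omega> > y then 1 else 0::real) \<partial>M) \<in> borel_measurable lborel"
          by measurable
        also have "(\<lambda>y. \<integral>\<omega>. (if U \<omega> > y then 1 else 0::real) \<partial>M) = (\<lambda>y. \<integral>\<omega>. indicator {\<omega>\<in>space M. U \<omega> > y} \<omega> \<partial>M)"
          by (intro ext Bochner_Integration.integral_cong) (auto simp: indicator_def)
        finally show ?thesis .
      qed
      then show ?thesis by simp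
    qed
    have "integrable lborel (\<lambda>y. indicator {0..x} y :: real)"
      using x by (simp)
    then show "integrable lborel (\<lambda>y. indicator {0..x} y * prob {\<omega>\<in>space M. U \<omega> > y})"
      by (rule Bochner_Integration.integrable_bound) (auto simp: indicator_def)
  qed (auto)
  also have "\<dots> = (\<integral>\<^sup>+y. \<integral>\<^sup>+\<omega>. (if 0 \<le> y \<and> y \<le> x \<and> y < U \<omega> then 1 else 0) \<partial>M \<partial>lborel)"
  proof (intro nn_integral_cong)
    fix y
    have "(\<integral>\<^sup>+\<omega>. (if 0 \<le> y \<and> y \<le> x \<and> y < U \<omega> then 1 else 0) \<partial>M)
        = (\<integral>\<^sup>+\<omega>. indicator {0..x} y * indicator {\<omega>\<in>space M. U \<omega> > y} \<omega> \<partial>M)"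
      by (intro nn_integral_cong) (auto simp: indicator_def)
    also have "\<dots> = indicator {0..x} y * emeasure M {\<omega>\<in>space M. U \<omega> > y}"
      by (simp add: nn_integral_cmult)
    finally show "ennreal (indicator {0..x} y * prob {\<omega>\<in>space M. U \<omega> > y}) =
       (\<integral>\<^sup>+\<omega>. (if 0 \<le> y \<and> y \<le> x \<and> y < U \<omega> then 1 else 0) \<partial>M)"
      by (simp add: emeasure_eq_measure indicator_def)
  qed
  also have "\<dots> = (\<integral>\<^sup>+\<omega>. \<integral>\<^sup>+y. (if 0 \<le> y \<and> y \<le> x \<and> y < U \<omega> then 1 else 0) \<partial>lborel \<partial>M)"
    by (rule P.Fubini') measurable
  also have "\<dots> = (\<integral>\<^sup>+\<omega>. ennreal (min (max (U \<omega>) 0) x) \<partial>M)"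
  proof (intro nn_integral_cong)
    fix \<omega>
    have "(\<integral>\<^sup>+y. (if 0 \<le> y \<and> y \<le> x \<and> y < U \<omega> then 1 else 0) \<partial>lborel)
       = (\<integral>\<^sup>+y. indicator (if U \<omega> \<le> x then {0..<U \<omega>} else {0..x}) y \<partial>lborel)"
      by (intro nn_integral_cong) (auto simp: indicator_def)
    also have "\<dots> = ennreal (min (max (U \<omega>) 0) x)"
      using x by (cases "0 \<le> U \<omega>") (auto simp: min_def max_def)
    finally show "(\<integral>\<^sup>+y. (if 0 \<le> y \<and> y \<le> x \<and> y < U \<omega> then 1 else 0) \<partial>lborel) = ennreal (min (max (U \<omega>) 0) x)" .
  qed
  also have "\<dots> = ennreal (expectation (\<lambda>\<omega>. min (max (U \<omega>) 0) x))"
    by (intro nn_integral_eq_integral integrable_const_bound[where B=x]) (use x in auto)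
  finally have eq: "ennreal (A_plus M U x) = ennreal (expectation (\<lambda>\<omega>. min (max (U \<omega>) 0) x))" .
  have "0 \<le> A_plus M U x" unfolding A_plus_def set_lebesgue_integral_def
    by (intro Bochner_Integration.integral_nonneg) auto
  moreover have "0 \<le> expectation (\<lambda>\<omega>. min (max (U \<omega>) 0) x)"
    by (intro Bochner_Integration.integral_nonneg) (use x in auto)
  ultimately show ?thesis using eq by (simp add: ennreal_inj)
qed

lemma integrable_min_pos[simp, intro]:
  assumes [measurable]: "U \<in> borel_measurable M" and "0 \<le> x"
  shows "integrable M (\<lambda>\<omega>. min (max (U \<omega>) 0) x :: real)"
  by (intro integrable_const_bound[where B=x]) (use assms in auto)

end

locale truncated_mean = prob_space M for M :: "'a measure" +
  fixes U :: "'a \<Rightarrow> real"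
  assumes measurable_U [measurable]: "U \<in> borel_measurable M"
    and pos: "prob {\<omega> \<in> space M. U \<omega> > 0} > 0"
begin

abbreviation A :: "real \<Rightarrow> real" where "A \<equiv> A_plus M U"
abbreviation J :: "real \<Rightarrow> real" where "J \<equiv> J_plus M U"

lemma A_eq: "0 \<le> x \<Longrightarrow> A x = expectation (\<lambda>\<omega>. min (max (U \<omega>) 0) x)"
  by (rule A_plus_eq_expectation) simp_all

lemma A_mono: "0 \<le> x \<Longrightarrow> x \<le> y \<Longrightarrow> A x \<le> A y"
  by (simp add: A_eq) (intro integral_mono, auto)

lemma A_le: "0 \<le> x \<Longrightarrow> A x \<le> x"
  using integral_mono[OF integrable_min_pos[OF measurable_U, of x] integrable_const[of x]]
  by (simp add: A_eq prob_space)

lemma A_pos: assumes "0 < x" shows "0 < A x"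
proof (rule ccontr)
  assume "\<not> 0 < A x"
  moreover have "0 \<le> A x" using assms by (simp add: A_eq)
  ultimately have "A x = 0" by linarith
  then have "expectation (\<lambda>\<omega>. min (max (U \<omega>) 0) x) = 0" using assms A_eq[of x] by simp
  then have "AE \<omega> in M. min (max (U \<omega>) 0) x = 0"
    using assms by (subst (asm) integral_nonneg_eq_0_iff_AE) auto
  then have "AE \<omega> in M. \<not> U \<omega> > 0" by eventually_elim (use assms in auto)
  then have "prob {\<omega> \<in> space M. U \<omega> > 0} = 0" by (subst prob_eq_0) auto
  with pos show False by simp
qed

lemma J_eq: "0 < x \<Longrightarrow> J x = x / A x"
  by (simp add: J_plus_def)

text \<open>For fixed \<open>u \<ge> 0\<close> the function \<open>min u y\<close> of
  \<open>y\<close> is concave and vanishes at 0, so \<open>min u y / y\<close> decreases;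
  expectations preserve this.\<close>

lemma A_div_antimono: assumes "0 < x" "x \<le> y" shows "A y / y \<le> A x / x"
proof -
  have "x * A y \<le> y * A x"
  proof -
    have "x * A y = expectation (\<lambda>\<omega>. x * min (max (U \<omega>) 0) y)" using assms by (simp add: A_eq)
    also have "\<dots> \<le> expectation (\<lambda>\<omega>. y * min (max (U \<omega>) 0) x)"
    proof (rule integral_mono)
      fix \<omega>
      have "x * min u y \<le> y * min u x" if "0 \<le> u" for u
        using assms that mult_mono[of x y u u] mult_mono[of x y u x]
        by (auto simp: min_def mult.commute intro: mult_left_mono)
      then show "x * min (max (U \<omega>) 0) y \<le> y * min (max (U \<omega>) 0) x" by simp
    qed (use assms in auto)
    also have "\<dots> = y * A x" using assms by (simp add: A_eq)
    finally show ?thesis .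
  qed
  then show ?thesis using assms by (simp add: field_simps)
qed

text \<open>At positive arguments this inverts \<open>A_div_antimono\<close>. The special value at 0
  fits in because \<open>A y\<close> is at most \<open>y\<close> times the probability of
  \<open>U > 0\<close>.\<close>

lemma J_mono: assumes "0 \<le> x" "x \<le> y" shows "J x \<le> J y"
proof -
  consider "y = 0" | "x = 0" "y > 0" | "x > 0" using assms by force
  then show ?thesis
  proof cases
    case 2
    have "A y \<le> expectation (\<lambda>\<omega>. y * indicator {\<omega> \<in> space M. U \<omega> > 0} \<omega>)"
      unfolding A_eq[OF less_imp_le[OF \<open>y > 0\<close>]]
      by (intro integral_mono integrable_min_pos integrable_mult_right integrable_real_indicator)
        (use 2 in \<open>auto simp: indicator_def emeasure_eq_measure\<close>)
    also have "\<dots> = y * prob {\<omega> \<in> space M. U \<omega> > 0}" by simp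
    finally have "1 / prob {\<omega> \<in> space M. U \<omega> > 0} \<le> y / A y"
      using A_pos[of y] pos 2 by (simp add: field_simps)
    then show ?thesis using 2 by (simp add: J_plus_def)
  next
    case 3
    then have "A y / y \<le> A x / x" using assms A_div_antimono by blast
    moreover have "0 < A y / y" using A_pos[of y] 3 assms by simp
    ultimately have "inverse (A x / x) \<le> inverse (A y / y)" by (intro le_imp_inverse_le)
    then show ?thesis using 3 assms by (simp add: J_eq)
  qed (use assms in auto)
qed

lemma J_ge_1: assumes "0 \<le> x" shows "1 \<le> J x"
proof -
  have "1 \<le> J 0" using pos by (simp add: J_plus_def)
  then show ?thesis using J_mono[of 0 x] assms by simp
qed

text \<open>Only the numerator doubles, while \<open>A\<close> can but grow. This permits a change
  of argument by a constant factor when \<open>J\<close> cannot be inverted exactly.\<close>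

lemma J_double: assumes "0 < x" shows "J (2 * x) \<le> 2 * J x"
proof -
  have "A x \<le> A (2*x)" using assms by (intro A_mono) auto
  then have "2 * x / A (2 * x) \<le> 2 * x / A x"
    using A_pos[of x] assms by (intro divide_left_mono) (auto intro: mult_pos_pos A_pos)
  then show ?thesis using assms by (simp add: J_eq)
qed

lemma measurable_J_neg_part [measurable]:
  assumes [measurable]: "V \<in> borel_measurable N"
  shows "(\<lambda>\<omega>. J (max (V \<omega>) 0)) \<in> borel_measurable N"
proof -
  have "mono (\<lambda>z. J (max z 0))" by (auto intro!: monoI J_mono)
  then have [measurable]: "(\<lambda>z. J (max z 0)) \<in> borel_measurable borel" by (rule borel_measurable_mono)
  show ?thesis using measurable_compose[OF assms, of "\<lambda>z. J (max z 0)" borel] by simp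
qed

lemma J_max: "0 \<le> x \<Longrightarrow> 0 \<le> y \<Longrightarrow> J (max x y) = max (J x) (J y)"
  using J_mono[of x y] J_mono[of y x] by (auto simp: max_def)

end

section \<open>Truncated steps: drift and exponential moments\<close>

definition clamp_real :: "real \<Rightarrow> real \<Rightarrow> real" where
  "clamp_real b t = max (- b) (min t b)"

lemma clamp_real_eq: "0 \<le> b \<Longrightarrow> clamp_real b t = min (max t 0) b - min (max (- t) 0) b"
  by (auto simp: clamp_real_def max_def min_def)

lemma abs_clamp_real: "0 \<le> b \<Longrightarrow> \<bar>clamp_real b t\<bar> = min (max t 0) b + min (max (- t) 0) b"
  by (auto simp: clamp_real_def max_def min_def)

lemma abs_clamp_real_le: "0 \<le> b \<Longrightarrow> \<bar>clamp_real b t\<bar> \<le> b"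
  by (auto simp: clamp_real_def max_def min_def)

lemma clamp_real_le: "- b \<le> t \<Longrightarrow> clamp_real b t \<le> t"
  by (auto simp: clamp_real_def)

lemma measurable_clamp_real [measurable]: "clamp_real b \<in> borel_measurable borel"
  unfolding clamp_real_def by measurable

lemma exp_le_quadratic:
  fixes x :: real assumes "\<bar>x\<bar> \<le> 1" shows "exp x \<le> 1 + x + x\<^sup>2"
proof (cases "0 \<le> x")
  case True then show ?thesis using exp_bound[of x] assms by simp
next
  case False
  define y where "y = - x"
  have y: "0 < y" "y \<le> 1" using False assms by (auto simp: y_def)
  \<comment> \<open>The product is \<open>1 + y ^ 3\<close>.\<close>
  have "1 \<le> (1 - y + y\<^sup>2) * (1 + y)"
    using y by (simp add: algebra_simps power2_eq_square)
  also have "\<dots> \<le> (1 - y + y\<^sup>2) * exp y"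
    using y exp_ge_add_one_self[of y] by (intro mult_left_mono) auto
  finally have "exp (- y) \<le> 1 - y + y\<^sup>2" by (simp add: exp_minus field_simps)
  then show ?thesis by (simp add: y_def)
qed

context truncated_mean
begin

text \<open>
  The drift of the truncated variable is comparable with \<open>A\<close>: if \<open>A\<close> is unbounded, dominated
  convergence shows that the negative part is negligible at every scale, and if \<open>A\<close> is bounded,
  then \<open>U\<close> is integrable and its mean decides.
\<close>
lemma truncated_negative_part_le:
  assumes J1: "integrable M (\<lambda>\<omega>. J (max (- U \<omega>) 0))"
    and drift: "integrable M U \<Longrightarrow> 0 < expectation U"
  shows "\<exists>\<kappa> b0. 0 < \<kappa> \<and> \<kappa> \<le> 1 \<and> 0 < b0 \<and>
    (\<forall>b\<ge>b0. expectation (\<lambda>\<omega>. min (max (- U \<omega>) 0) b) \<le> (1 - \<kappa>) * A b)"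
proof (cases "\<exists>B. \<forall>b>0. A b \<le> B")
  case True
  then obtain B where B: "\<And>b. 0 < b \<Longrightarrow> A b \<le> B" by auto
  have inc: "incseq (\<lambda>n. A (real n))" by (auto intro!: incseq_SucI A_mono)
  have "A (real n) \<le> A 1 + B" for n
    using B[of "real n"] A_pos[of 1] A_le[of 0] B[of 1] by (cases n) auto
  with inc obtain L where L: "(\<lambda>n. A (real n)) \<longlonglongrightarrow> L"
    using incseq_convergent[of "\<lambda>n. A (real n)" "A 1 + B"] by blast
  have mc: "has_bochner_integral M (\<lambda>\<omega>. max (U \<omega>) 0) L"
  proof (rule has_bochner_integral_monotone_convergence[where f="\<lambda>n \<omega>. min (max (U \<omega>) 0) (real n)"])
    show "AE \<omega> in M. mono (\<lambda>n. min (max (U \<omega>) 0) (real n))" by (auto intro!: monoI)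
    show "AE \<omega> in M. (\<lambda>n. min (max (U \<omega>) 0) (real n)) \<longlonglongrightarrow> max (U \<omega>) 0"
    proof (intro AE_I2 tendsto_eventually)
      fix \<omega> show "\<forall>\<^sub>F n in sequentially. min (max (U \<omega>) 0) (real n) = max (U \<omega>) 0"
        using eventually_ge_at_top[of "nat \<lceil>U \<omega>\<rceil>"] by eventually_elim (auto simp: min_def; linarith)
    qed
    show "(\<lambda>n. expectation (\<lambda>\<omega>. min (max (U \<omega>) 0) (real n))) \<longlonglongrightarrow> L"
      using L by (simp add: A_eq)
  qed auto
  have Up: "integrable M (\<lambda>\<omega>. max (U \<omega>) 0)" "expectation (\<lambda>\<omega>. max (U \<omega>) 0) = L"
    using mc by (auto simp: has_bochner_integral_iff)
  have Bpos: "0 < B" using A_pos[of 1] B[of 1] by simp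
  have Um: "integrable M (\<lambda>\<omega>. max (- U \<omega>) 0)"
  proof (rule Bochner_Integration.integrable_bound)
    show "integrable M (\<lambda>\<omega>. B * J (max (- U \<omega>) 0))" using J1 by simp
    \<comment> \<open>Since \<open>z = J z * A z\<close> for \<open>z > 0\<close> and
      \<open>A\<close> is bounded by \<open>B\<close>, integrability of \<open>J\<close> at the
      negative part gives integrability of the negative part itself.\<close>
    have "z \<le> B * J z" if "0 \<le> z" for z
    proof (cases "z = 0")
      case False
      then have "z / A z * A z \<le> z / A z * B" using that A_pos[of z] B[of z] by (intro mult_left_mono) auto
      then show ?thesis using False that A_pos[of z] by (simp add: J_eq mult.commute)
    qed (use J_ge_1[of 0] Bpos in \<open>auto intro!: mult_nonneg_nonneg\<close>)
    then have "max (- U \<omega>) 0 \<le> B * J (max (- U \<omega>) 0)" for \<omega> using max.cobounded2 by blast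
    then show "AE \<omega> in M. norm (max (- U \<omega>) 0) \<le> norm (B * J (max (- U \<omega>) 0))"
      by (auto intro!: AE_I2 intro: order_trans[OF _ abs_ge_self])
  qed auto
  define K where "K = expectation (\<lambda>\<omega>. max (- U \<omega>) 0)"
  have K0: "0 \<le> K" by (auto simp: K_def)
  have Ueq: "U = (\<lambda>\<omega>. max (U \<omega>) 0 - max (- U \<omega>) 0)" by (auto simp: max_def)
  have "integrable M U" by (subst Ueq) (intro Bochner_Integration.integrable_diff Up Um)
  then have "0 < expectation U" by (rule drift)
  also have "expectation U = L - K"
    by (subst Ueq) (subst Bochner_Integration.integral_diff, use Up Um in \<open>auto simp: K_def\<close>)
  finally have KL: "K < L" by simp
  \<comment> \<open>This makes \<open>1 - \<kappa>\<close> the midpoint of \<open>K / L\<close> and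
    1. The claim then needs only \<open>A b \<ge> 2 * K * L / (L + K)\<close>, a bound strictly
    below the limit \<open>L\<close> of \<open>A\<close>.\<close>
  define \<kappa> where "\<kappa> = (L - K) / (2 * L)"
  have \<kappa>: "0 < \<kappa>" "\<kappa> \<le> 1" "1 - \<kappa> = (L + K) / (2 * L)" using KL K0 by (auto simp: \<kappa>_def field_simps)
  have "2 * K * L < L * (L + K)" using KL K0 by (simp add: algebra_simps)
  then have "2 * K * L / (L + K) < L" using KL K0 by (simp add: divide_simps)
  then have "eventually (\<lambda>n. 2 * K * L / (L + K) < A (real n)) sequentially"
    using L by (simp add: order_tendstoD)
  then obtain n0 where n0: "2 * K * L / (L + K) < A (real n0)" by (auto simp: eventually_sequentially)
  have "expectation (\<lambda>\<omega>. min (max (- U \<omega>) 0) b) \<le> (1 - \<kappa>) * A b" if "b \<ge> max 1 (real n0)" for b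
  proof -
    have "expectation (\<lambda>\<omega>. min (max (- U \<omega>) 0) b) \<le> K" unfolding K_def
      using that by (intro integral_mono Um integrable_min_pos[where U="\<lambda>\<omega>. - U \<omega>"]) auto
    also have "K = (1 - \<kappa>) * (2 * K * L / (L + K))"
    proof -
      have "D / (2 * L) * (2 * K * L / D) = K" if "D \<noteq> 0" for D using that KL K0 by simp
      from this[of "L + K"] show ?thesis unfolding \<kappa>(3) using KL K0 by simp
    qed
    also have "\<dots> \<le> (1 - \<kappa>) * A b"
      using n0 A_mono[of "real n0" b] that \<kappa> by (intro mult_left_mono) auto
    finally show ?thesis .
  qed
  then show ?thesis using \<kappa> by (intro exI[of _ \<kappa>] exI[of _ "max 1 (real n0)"]) auto
next
  case False
  have Ainf: "filterlim A at_top at_top"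
    unfolding filterlim_at_top
  proof
    fix Z
    from False obtain b where "0 < b" "Z \<le> A b" by (metis linear)
    then show "\<forall>\<^sub>F x in at_top. Z \<le> A x"
      unfolding eventually_at_top_linorder by (intro exI[of _ b]) (use \<open>0 < b\<close> \<open>Z \<le> A b\<close> A_mono[of b] in force)
  qed
  have "((\<lambda>t. expectation (\<lambda>\<omega>. min (max (- U \<omega>) 0) t / A t)) \<longlongrightarrow> expectation (\<lambda>\<omega>. 0)) at_top"
  proof (rule integral_dominated_convergence_at_top[OF _ _ J1])
    show "\<forall>\<^sub>F t in at_top. AE \<omega> in M. norm (min (max (- U \<omega>) 0) t / A t) \<le> J (max (- U \<omega>) 0)"
      using eventually_gt_at_top[of 0]
    proof eventually_elim
      case (elim t)
      \<comment> \<open>Domination: for \<open>z \<le> t\<close> replace \<open>A t\<close> by the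
        smaller \<open>A z\<close>; for \<open>t < z\<close> the quotient is \<open>J t\<close>, and
        \<open>J\<close> is monotone.\<close>
      have "min z t / A t \<le> J z" if z: "0 \<le> z" for z
      proof -
        consider "z = 0" | "0 < z" "z \<le> t" | "t < z" using z by linarith
        then show ?thesis
        proof cases
          case 2
          then have "z / A t \<le> z / A z" using A_pos[of z] A_mono[of z t] elim
            by (intro divide_left_mono) (auto intro: mult_pos_pos A_pos)
          then show ?thesis using 2 by (simp add: J_eq)
        next
          case 3
          then show ?thesis using J_mono[of t z] elim by (simp add: J_eq)
        qed (use J_ge_1[of 0] elim in auto)
      qed
      then show ?case using A_pos[OF elim] elim by (auto intro!: AE_I2)
    qed
    show "AE \<omega> in M. ((\<lambda>t. min (max (- U \<omega>) 0) t / A t) \<longlongrightarrow> 0) at_top"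
    proof (intro AE_I2)
      fix \<omega>
      have "((\<lambda>t. max (- U \<omega>) 0 / A t) \<longlongrightarrow> 0) at_top"
        by (intro tendsto_divide_0[OF tendsto_const] filterlim_at_top_imp_at_infinity Ainf)
      moreover have "\<forall>\<^sub>F t in at_top. max (- U \<omega>) 0 / A t = min (max (- U \<omega>) 0) t / A t"
        using eventually_ge_at_top[of "max (- U \<omega>) 0"] by eventually_elim (auto simp: min_def)
      ultimately show "((\<lambda>t. min (max (- U \<omega>) 0) t / A t) \<longlongrightarrow> 0) at_top"
        by (rule Lim_transform_eventually)
    qed
  qed auto
  then have "\<forall>\<^sub>F t in at_top. expectation (\<lambda>\<omega>. min (max (- U \<omega>) 0) t / A t) < 1/2"
    by (intro order_tendstoD(2)[where y=0]) auto
  then have "\<forall>\<^sub>F t in at_top. expectation (\<lambda>\<omega>. min (max (- U \<omega>) 0) t) \<le> (1 - 1/2) * A t"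
    using eventually_gt_at_top[of 0]
    by eventually_elim (use A_pos in \<open>simp add: field_simps\<close>)
  then have "\<forall>\<^sub>F t in at_top. 0 < t \<and> expectation (\<lambda>\<omega>. min (max (- U \<omega>) 0) t) \<le> (1 - 1/2) * A t"
    using eventually_gt_at_top[of 0] by eventually_elim simp
  then obtain b0 where "\<And>b. b \<ge> b0 \<Longrightarrow> 0 < b \<and> expectation (\<lambda>\<omega>. min (max (- U \<omega>) 0) b) \<le> (1 - 1/2) * A b"
    unfolding eventually_at_top_linorder by auto
  then show ?thesis by (intro exI[of _ "1/2"] exI[of _ b0]) auto
qed

text \<open>With \<open>t\<close> the truncated variable divided by \<open>b\<close>,
  \<open>\<bar>t\<bar> \<le> 1\<close> gives \<open>t\<^sup>2 \<le> \<bar>t\<bar>\<close>. So the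
  second-order term is controlled by \<open>A b / b\<close>, the same quantity that bounds the drift
  from below, and no second moment enters.\<close>

lemma truncated_laplace_le:
  assumes \<kappa>: "0 < \<kappa>" "\<kappa> \<le> 1" and b: "0 < b"
    and neg: "expectation (\<lambda>\<omega>. min (max (- U \<omega>) 0) b) \<le> (1 - \<kappa>) * A b"
  shows "expectation (\<lambda>\<omega>. exp (- (\<kappa> / 4 * clamp_real b (U \<omega>) / b))) \<le> exp (- (\<kappa>\<^sup>2 / 8 / J b))"
proof -
  define t where "t = (\<lambda>\<omega>. clamp_real b (U \<omega>) / b)"
  \<comment> \<open>The gain is \<open>\<theta> * \<kappa> - 2 * \<theta>\<^sup>2\<close> times
    \<open>A b / b\<close>; it is largest at \<open>\<theta> = \<kappa> / 4\<close>, with value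
    \<open>\<kappa>\<^sup>2 / 8\<close>.\<close>
  define \<theta> where "\<theta> = \<kappa> / 4"
  have [measurable]: "t \<in> borel_measurable M" unfolding t_def by measurable
  have t1: "\<bar>t \<omega>\<bar> \<le> 1" for \<omega> using abs_clamp_real_le[of b] b by (simp add: t_def)
  have \<theta>: "0 < \<theta>" "\<theta> \<le> 1" using \<kappa> by (auto simp: \<theta>_def)
  have \<theta>t: "\<bar>\<theta> * t \<omega>\<bar> \<le> 1" for \<omega>
    using \<theta> mult_mono[of \<theta> 1 "\<bar>t \<omega>\<bar>" 1] t1[of \<omega>] by (simp add: abs_mult)
  have it: "integrable M t" by (intro integrable_const_bound[where B=1]) (use t1 in auto)
  have ineg: "integrable M (\<lambda>\<omega>. min (max (- U \<omega>) 0) b)"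
    using integrable_min_pos[where U="\<lambda>\<omega>. - U \<omega>"] b by simp
  have ipos: "integrable M (\<lambda>\<omega>. min (max (U \<omega>) 0) b)" using b by auto
  let ?m = "expectation (\<lambda>\<omega>. min (max (- U \<omega>) 0) b)"
  have Et: "expectation t = (A b - ?m) / b"
    using b ineg ipos unfolding t_def by (simp add: clamp_real_eq A_eq)
  have Eabs: "expectation (\<lambda>\<omega>. \<bar>t \<omega>\<bar>) = (A b + ?m) / b"
    using b ineg ipos unfolding t_def by (simp add: abs_clamp_real A_eq)
  have "expectation (\<lambda>\<omega>. exp (- (\<theta> * t \<omega>))) \<le> expectation (\<lambda>\<omega>. 1 - \<theta> * t \<omega> + \<theta>\<^sup>2 * \<bar>t \<omega>\<bar>)"
  proof (rule integral_mono)
    show "integrable M (\<lambda>\<omega>. exp (- (\<theta> * t \<omega>)))"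
    proof (intro integrable_const_bound[where B="exp 1"] AE_I2)
      fix \<omega> show "norm (exp (- (\<theta> * t \<omega>))) \<le> exp 1" using \<theta>t[of \<omega>] by simp
    qed auto
    show "integrable M (\<lambda>\<omega>. 1 - \<theta> * t \<omega> + \<theta>\<^sup>2 * \<bar>t \<omega>\<bar>)" using it by auto
    fix \<omega>
    have "exp (- (\<theta> * t \<omega>)) \<le> 1 - \<theta> * t \<omega> + (\<theta> * t \<omega>)\<^sup>2"
      using exp_le_quadratic[of "- (\<theta> * t \<omega>)"] \<theta>t[of \<omega>] by simp
    also have "(\<theta> * t \<omega>)\<^sup>2 \<le> \<theta>\<^sup>2 * \<bar>t \<omega>\<bar>"
      using mult_left_mono[OF mult_mono[OF t1[of \<omega>] order_refl[of "\<bar>t \<omega>\<bar>"]], of "\<theta>\<^sup>2"]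
      by (simp add: power_mult_distrib power2_eq_square mult_ac)
    finally show "exp (- (\<theta> * t \<omega>)) \<le> 1 - \<theta> * t \<omega> + \<theta>\<^sup>2 * \<bar>t \<omega>\<bar>" by simp
  qed
  also have "\<dots> = 1 - \<theta> * ((A b - ?m) / b) + \<theta>\<^sup>2 * ((A b + ?m) / b)"
    using it by (simp add: prob_space Et Eabs)
  also have "\<dots> \<le> 1 - \<theta> * (\<kappa> * A b / b) + \<theta>\<^sup>2 * (2 * A b / b)"
  proof -
    have "?m \<le> A b" using neg \<kappa> A_pos[OF b] by (smt (verit, ccfv_SIG) mult_left_le_one_le)
    then have "(A b + ?m) / b \<le> 2 * A b / b" using b by (intro divide_right_mono) auto
    moreover have "\<kappa> * A b / b \<le> (A b - ?m) / b"
      using neg b by (intro divide_right_mono) (auto simp: algebra_simps)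
    ultimately have "\<theta>\<^sup>2 * ((A b + ?m) / b) \<le> \<theta>\<^sup>2 * (2 * A b / b)"
      "\<theta> * (\<kappa> * A b / b) \<le> \<theta> * ((A b - ?m) / b)"
      using \<theta> by (intro mult_left_mono; simp)+
    then show ?thesis by linarith
  qed
  also have "\<dots> = 1 - \<kappa>\<^sup>2 / 8 / J b"
    using b A_pos[OF b] by (simp add: \<theta>_def J_eq power2_eq_square field_simps)
  also have "\<dots> \<le> exp (- (\<kappa>\<^sup>2 / 8 / J b))"
    using exp_ge_add_one_self[of "- (\<kappa>\<^sup>2 / 8 / J b)"] by simp
  finally show ?thesis unfolding \<theta>_def t_def by simp
qed

end

section \<open>Independence of past and future\<close>

context perturbed_random_walk
begin

abbreviation X :: "nat \<Rightarrow> 'a \<Rightarrow> real \<times> real" where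
  "X n \<equiv> \<lambda>\<omega>. (\<xi> n \<omega>, \<eta> n \<omega>)"

lemma measurable_X [measurable]: "X n \<in> borel_measurable M"
  using indep by (auto simp: indep_vars_def)

lemma measurable_fst_borel [measurable]: "fst \<in> borel_measurable (borel :: (real \<times> real) measure)"
  and measurable_snd_borel [measurable]: "snd \<in> borel_measurable (borel :: (real \<times> real) measure)"
  by (simp_all add: borel_prod[symmetric])

lemma measurable_xi [measurable]: "\<xi> n \<in> borel_measurable M"
  using measurable_compose[OF measurable_X measurable_fst_borel] by simp

lemma measurable_eta [measurable]: "\<eta> n \<in> borel_measurable M"
  using measurable_compose[OF measurable_X measurable_snd_borel] by simp

lemma measurable_walk [measurable]: "walk \<xi> n \<in> borel_measurable M"
  unfolding walk_def by measurable

lemma measurable_perturbed_walk [measurable]: "perturbed_walk \<xi> \<eta> n \<in> borel_measurable M"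
  unfolding perturbed_walk_def by measurable

lemma distr_X: "distr M borel (X n) = distr M borel (X 0)"
  using ident_distr .

lemma prob_X_eq:
  assumes "B \<in> sets borel"
  shows "prob {\<omega> \<in> space M. X n \<omega> \<in> B} = prob {\<omega> \<in> space M. X 0 \<omega> \<in> B}"
proof -
  have "prob {\<omega> \<in> space M. X n \<omega> \<in> B} = measure (distr M borel (X n)) B" for n
    using assms by (subst measure_distr) (auto intro!: arg_cong[where f=prob])
  then show ?thesis using distr_X by metis
qed

lemma expectation_X_eq:
  fixes f :: "real \<times> real \<Rightarrow> real"
  assumes [measurable]: "f \<in> borel_measurable borel"
  shows "expectation (\<lambda>\<omega>. f (X n \<omega>)) = expectation (\<lambda>\<omega>. f (X 0 \<omega>))"
  using integral_distr[of "X n" M borel f] integral_distr[of "X 0" M borel f] distr_X[of n] by simp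

lemma integrable_X_iff:
  fixes f :: "real \<times> real \<Rightarrow> real"
  assumes [measurable]: "f \<in> borel_measurable borel"
  shows "integrable M (\<lambda>\<omega>. f (X n \<omega>)) \<longleftrightarrow> integrable M (\<lambda>\<omega>. f (X 0 \<omega>))"
  using integrable_distr_eq[of "X n" M borel f] integrable_distr_eq[of "X 0" M borel f] distr_X[of n] by simp

text \<open>The natural filtration, generated by one map into a product space so that each event is
  a preimage to which \<open>indep_var_restrict\<close> applies. The generic pair with index 0 is
  left out.\<close>

definition past :: "nat \<Rightarrow> 'a measure" where
  "past k = vimage_algebra (space M) (\<lambda>\<omega>. \<lambda>i\<in>{1..k}. X i \<omega>) (\<Pi>\<^sub>M i\<in>{1..k}. borel)"

lemma space_past [simp]: "space (past k) = space M"
  by (simp add: past_def)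

lemma measurable_X_past:
  assumes "i \<in> {1..k}" shows "X i \<in> borel_measurable (past k)"
proof -
  have "(\<lambda>\<omega>. (\<lambda>i\<in>{1..k}. X i \<omega>) i) \<in> borel_measurable (past k)" unfolding past_def
    by (rule measurable_compose[OF measurable_vimage_algebra1 measurable_component_singleton[OF assms]])
      (auto simp: space_PiM)
  then show ?thesis using assms by simp
qed

lemma measurable_xi_past: "i \<in> {1..k} \<Longrightarrow> \<xi> i \<in> borel_measurable (past k)"
  using measurable_compose[OF measurable_X_past measurable_fst_borel] by simp

lemma measurable_walk_past [measurable]: "j \<le> k \<Longrightarrow> walk \<xi> j \<in> borel_measurable (past k)"
  unfolding walk_def by (intro borel_measurable_sum measurable_xi_past) auto

lemma past_subset:
  assumes "space N = space M" "\<And>i. i \<in> {1..k} \<Longrightarrow> X i \<in> borel_measurable N"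
  shows "sets (past k) \<subseteq> sets N"
proof
  fix D assume "D \<in> sets (past k)"
  then obtain B where B: "B \<in> sets (\<Pi>\<^sub>M i\<in>{1..k}. borel)"
    "D = (\<lambda>\<omega>. \<lambda>i\<in>{1..k}. X i \<omega>) -` B \<inter> space M"
    unfolding past_def by (subst (asm) sets_vimage_algebra2) (auto simp: space_PiM)
  have "(\<lambda>\<omega>. \<lambda>i\<in>{1..k}. X i \<omega>) \<in> measurable N (\<Pi>\<^sub>M i\<in>{1..k}. borel)"
    using assms(2) by (intro measurable_restrict)
  from measurable_sets[OF this B(1)] show "D \<in> sets N" unfolding B(2) assms(1) .
qed

lemma past_mono: "j \<le> k \<Longrightarrow> sets (past j) \<subseteq> sets (past k)"
  by (rule past_subset) (auto intro: measurable_X_past)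

lemma sets_past: "D \<in> sets (past k) \<Longrightarrow> D \<in> sets M"
  using past_subset[of M k] by auto

text \<open>Independence of the index blocks \<open>{1..k}\<close> and \<open>{Suc k}\<close>. The
  set \<open>B\<close> consists of pairs because only the pair as a whole is known to be independent
  of the past.\<close>

lemma prob_past_next:
  assumes D: "D \<in> sets (past k)" and B: "B \<in> sets borel"
  shows "prob (D \<inter> {\<omega> \<in> space M. X (Suc k) \<omega> \<in> B}) = prob D * prob {\<omega> \<in> space M. X 0 \<omega> \<in> B}"
proof -
  let ?f = "\<lambda>A \<omega>. \<lambda>i\<in>A. X i \<omega>"
  obtain C where C: "C \<in> sets (\<Pi>\<^sub>M i\<in>{1..k}. borel)" "D = ?f {1..k} -` C \<inter> space M"
    using D unfolding past_def by (subst (asm) sets_vimage_algebra2) (auto simp: space_PiM)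
  let ?B = "{f \<in> space (\<Pi>\<^sub>M i\<in>{Suc k}. borel). f (Suc k) \<in> B}"
  have B': "?B \<in> sets (\<Pi>\<^sub>M i\<in>{Suc k}. borel)"
    using B by measurable
  have "indep_var (\<Pi>\<^sub>M i\<in>{1..k}. borel) (?f {1..k}) (\<Pi>\<^sub>M i\<in>{Suc k}. borel) (?f {Suc k})"
    using indep by (rule indep_var_restrict) auto
  note indep_varD[OF this C(1) B']
  also have "(\<lambda>\<omega>. (?f {1..k} \<omega>, ?f {Suc k} \<omega>)) -` (C \<times> ?B) \<inter> space M
      = D \<inter> {\<omega> \<in> space M. X (Suc k) \<omega> \<in> B}"
  proof -
    have "?f {Suc k} \<omega> \<in> ?B \<longleftrightarrow> X (Suc k) \<omega> \<in> B" for \<omega>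
      by (simp add: space_PiM)
    then show ?thesis unfolding C(2) by blast
  qed
  also have "?f {Suc k} -` ?B \<inter> space M = {\<omega> \<in> space M. X (Suc k) \<omega> \<in> B}"
    by (auto simp: space_PiM)
  finally show ?thesis unfolding prob_X_eq[OF B, of "Suc k"] C(2)[symmetric] .
qed

text \<open>A strong Markov property: \<open>F k\<close> plays the role of the event that a stopping
  time, possibly infinite, equals \<open>k\<close>; summation over \<open>k\<close> shows that the
  pair after that time is fresh.\<close>

lemma prob_disjoint_past_next:
  assumes F: "\<And>k. F k \<in> sets (past k)" "disjoint_family F" and B: "B \<in> sets borel"
  shows "prob (\<Union>k. F k \<inter> {\<omega> \<in> space M. X (Suc k) \<omega> \<in> B}) = prob (\<Union>k. F k) * prob {\<omega> \<in> space M. X 0 \<omega> \<in> B}"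
proof -
  have [measurable]: "F k \<in> sets M" for k using sets_past F by auto
  have H[measurable]: "{\<omega> \<in> space M. X k \<omega> \<in> B} \<in> sets M" for k
    using measurable_sets[OF measurable_X B, of k] by (auto simp: vimage_def Int_def conj_commute)
  have "(\<lambda>k. prob (F k)) sums prob (\<Union>k. F k)"
    using F by (intro finite_measure_UNION) auto
  then have 1: "(\<lambda>k. prob (F k) * prob {\<omega> \<in> space M. X 0 \<omega> \<in> B}) sums (prob (\<Union>k. F k) * prob {\<omega> \<in> space M. X 0 \<omega> \<in> B})"
    by (rule sums_mult2)
  have "(\<lambda>k. prob (F k \<inter> {\<omega> \<in> space M. X (Suc k) \<omega> \<in> B})) sums prob (\<Union>k. F k \<inter> {\<omega> \<in> space M. X (Suc k) \<omega> \<in> B})"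
    using F(2) by (intro finite_measure_UNION) (auto simp: disjoint_family_on_def intro!: sets.Int)
  with 1 show ?thesis using sums_unique2 prob_past_next[OF F(1) B] by simp
qed

text \<open>If some success had probability below 1/4, then at each time \<open>F k\<close> without
  an earlier success would have probability at least \<open>1 / 2 - 1 / 4\<close>, so a first
  success at \<open>k\<close> would have at least \<open>q / 4\<close>. First successes are
  disjoint, hence their \<open>n\<close> contributions add up to \<open>n * q / 4\<close>.\<close>

lemma prob_some_success:
  assumes F: "\<And>k. F k \<in> sets (past k)" "\<And>k. k \<in> {n..<2 * n} \<Longrightarrow> 1 / 2 \<le> prob (F k)"
    and B: "B \<in> sets borel"
  shows "min (1 / 4) (n * prob {\<omega> \<in> space M. X 0 \<omega> \<in> B} / 4)
    \<le> prob (\<Union>k\<in>{n..<2 * n}. F k \<inter> {\<omega> \<in> space M. X (Suc k) \<omega> \<in> B})"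
proof (rule ccontr)
  define q where "q = prob {\<omega> \<in> space M. X 0 \<omega> \<in> B}"
  define H where "H = (\<lambda>k. {\<omega> \<in> space M. X (Suc k) \<omega> \<in> B})"
  define E where "E = (\<lambda>k. \<Union>j\<in>{n..<k}. F j \<inter> H j)"
  define D where "D = (\<lambda>k. F k - E k)"
  assume "\<not> ?thesis"
  then have lt: "prob (E (2 * n)) < 1 / 4" "prob (E (2 * n)) < n * q / 4"
    by (auto simp: E_def H_def q_def)
  have H: "H k \<in> sets (past (Suc k))" for k
    using measurable_sets[OF measurable_X_past B, of "Suc k" "Suc k"]
    by (auto simp: H_def vimage_def Int_def conj_commute)
  have FH: "F j \<inter> H j \<in> sets (past k)" if "j < k" for j k
    using that F(1)[of j] past_mono[of j k] past_mono[of "Suc j" k] H[of j] by (intro sets.Int) auto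
  have E: "E k \<in> sets (past k)" for k unfolding E_def by (intro sets.finite_UN FH) auto
  have D: "D k \<in> sets (past k)" for k unfolding D_def using F(1) E by auto
  have [measurable]: "F k \<in> sets M" "H k \<in> sets M" "E k \<in> sets M" "D k \<in> sets M" for k
    using F(1) H E D sets_past by blast+
  have Emono: "E k \<subseteq> E (2 * n)" if "k \<in> {n..<2*n}" for k using that by (force simp: E_def)
  have "n * (q / 4) \<le> (\<Sum>k\<in>{n..<2*n}. q / 4)" by simp
  also have "\<dots> \<le> (\<Sum>k\<in>{n..<2*n}. prob (D k \<inter> H k))"
  proof (rule sum_mono)
    fix k assume k: "k \<in> {n..<2*n}"
    have "1 / 2 - 1 / 4 \<le> prob (F k) - prob (E k)"
      using F(2)[OF k] lt(1) finite_measure_mono[OF Emono[OF k]] by auto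
    also have "\<dots> \<le> prob (D k)"
      using finite_measure_mono[of "F k" "D k \<union> E k"] measure_Un_le[of "D k" M "E k"]
      by (auto simp: D_def)
    finally have "q * (1 / 4) \<le> q * prob (D k)" by (intro mult_left_mono) (auto simp: q_def)
    then show "q / 4 \<le> prob (D k \<inter> H k)"
      using prob_past_next[OF D B, of k] by (simp add: H_def q_def mult.commute)
  qed
  also have "\<dots> = prob (\<Union>k\<in>{n..<2*n}. D k \<inter> H k)"
  proof (rule finite_measure_finite_Union[symmetric])
    show "disjoint_family_on (\<lambda>k. D k \<inter> H k) {n..<2*n}"
    proof -
      have "(D i \<inter> H i) \<inter> (D j \<inter> H j) = {}" if "i < j" "n \<le> i" for i j
        using that by (auto simp: D_def E_def)
      then show ?thesis unfolding disjoint_family_on_def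
        by (metis atLeastLessThan_iff inf_commute linorder_neqE_nat)
    qed
  qed auto
  also have "\<dots> \<le> prob (E (2 * n))"
    by (intro finite_measure_mono) (auto simp: E_def D_def)
  finally show False using lt(2) by simp
qed

end

section \<open>Passing divergence from the perturbed walk to the walk\<close>

context prob_space
begin

text \<open>Continuity from above. Together with \<open>AE_at_top_of_tail_prob\<close> it makes
  almost sure divergence a statement about probabilities, which can be compared up to
  constants.\<close>

lemma tail_prob_tendsto_0:
  fixes f :: "nat \<Rightarrow> 'a \<Rightarrow> real"
  assumes [measurable]: "\<And>n. f n \<in> borel_measurable M"
    and lim: "AE \<omega> in M. filterlim (\<lambda>n. f n \<omega>) at_top sequentially"
  shows "(\<lambda>m. prob {\<omega> \<in> space M. \<exists>n\<ge>m. f n \<omega> \<le> x}) \<longlonglongrightarrow> 0"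
proof -
  have "(\<lambda>m. prob {\<omega> \<in> space M. \<exists>n\<ge>m. f n \<omega> \<le> x}) \<longlonglongrightarrow> prob (\<Inter>m. {\<omega> \<in> space M. \<exists>n\<ge>m. f n \<omega> \<le> x})"
    by (intro finite_Lim_measure_decseq) (auto simp: decseq_def intro: order_trans)
  moreover have "AE \<omega> in M. \<omega> \<notin> (\<Inter>m. {\<omega> \<in> space M. \<exists>n\<ge>m. f n \<omega> \<le> x})"
    using lim
  proof eventually_elim
    case (elim \<omega>)
    then have "\<forall>\<^sub>F n in sequentially. x < f n \<omega>" by (simp add: filterlim_at_top_dense)
    then obtain m where "\<And>n. n \<ge> m \<Longrightarrow> x < f n \<omega>" by (auto simp: eventually_sequentially)
    then have "\<not> (\<exists>n\<ge>m. f n \<omega> \<le> x)" by (meson not_le)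
    then show ?case by auto
  qed
  then have "prob (\<Inter>m. {\<omega> \<in> space M. \<exists>n\<ge>m. f n \<omega> \<le> x}) = 0"
    by (subst prob_eq_0) auto
  ultimately show ?thesis by simp
qed

lemma AE_at_top_of_tail_prob:
  fixes f :: "nat \<Rightarrow> 'a \<Rightarrow> real"
  assumes [measurable]: "\<And>n. f n \<in> borel_measurable M"
    and lim: "\<And>x. (\<lambda>m. prob {\<omega> \<in> space M. \<exists>n\<ge>m. f n \<omega> \<le> x}) \<longlonglongrightarrow> 0"
  shows "AE \<omega> in M. filterlim (\<lambda>n. f n \<omega>) at_top sequentially"
proof -
  have "AE \<omega> in M. \<exists>m. \<forall>n\<ge>m. real L < f n \<omega>" for L :: nat
  proof -
    have "(\<lambda>m. prob {\<omega> \<in> space M. \<exists>n\<ge>m. f n \<omega> \<le> L}) \<longlonglongrightarrow> prob (\<Inter>m. {\<omega> \<in> space M. \<exists>n\<ge>m. f n \<omega> \<le> L})"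
      by (intro finite_Lim_measure_decseq) (auto simp: decseq_def intro: order_trans)
    then have "prob (\<Inter>m. {\<omega> \<in> space M. \<exists>n\<ge>m. f n \<omega> \<le> L}) = 0"
      using lim LIMSEQ_unique by blast
    then have "AE \<omega> in M. \<omega> \<notin> (\<Inter>m. {\<omega> \<in> space M. \<exists>n\<ge>m. f n \<omega> \<le> L})"
      by (subst (asm) prob_eq_0) auto
    with AE_space show ?thesis by eventually_elim (simp, meson not_le)
  qed
  then have "AE \<omega> in M. \<forall>L::nat. \<exists>m. \<forall>n\<ge>m. real L < f n \<omega>" by (simp add: AE_all_countable)
  then show ?thesis
  proof eventually_elim
    case (elim \<omega>)
    show ?case unfolding filterlim_at_top
    proof
      fix Z :: real
      obtain L :: nat where "Z \<le> real L" using real_arch_simple by blast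
      moreover obtain m where "\<forall>n\<ge>m. real L < f n \<omega>" using elim by blast
      ultimately show "\<forall>\<^sub>F n in sequentially. Z \<le> f n \<omega>"
        unfolding eventually_sequentially by (intro exI[of _ m]) (auto intro: order_trans less_imp_le)
    qed
  qed
qed

lemma ex_prob_le_pos:
  assumes [measurable]: "U \<in> borel_measurable M"
  shows "\<exists>K::real. 0 < prob {\<omega> \<in> space M. U \<omega> \<le> K}"
proof -
  have "(\<lambda>n. prob {\<omega> \<in> space M. U \<omega> \<le> real n}) \<longlonglongrightarrow> prob (\<Union>n. {\<omega> \<in> space M. U \<omega> \<le> real n})"
    by (intro finite_Lim_measure_incseq) (auto simp: incseq_def)
  also have "(\<Union>n. {\<omega> \<in> space M. U \<omega> \<le> real n}) = space M" using real_arch_simple by auto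
  finally have "\<forall>\<^sub>F n in sequentially. 0 < prob {\<omega> \<in> space M. U \<omega> \<le> real n}"
    by (intro order_tendstoD(1)) (auto simp: prob_space)
  then show ?thesis by (auto simp: eventually_sequentially)
qed

end

context perturbed_random_walk
begin

text \<open>
  Decomposition at the first time \<open>k \<ge> m\<close> with \<open>S\<^sub>k \<le> y\<close>, which is independent of the
  perturbation \<open>\<eta>\<^bsub>k+1\<^esub>\<close>.
\<close>
lemma prob_walk_tail_le:
  "prob {\<omega> \<in> space M. \<exists>k\<ge>m. walk \<xi> k \<omega> \<le> y} * prob {\<omega> \<in> space M. \<eta> 0 \<omega> \<le> K}
    \<le> prob {\<omega> \<in> space M. \<exists>n\<ge>m. perturbed_walk \<xi> \<eta> n \<omega> \<le> y + K}"
proof -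
  define F where "F = (\<lambda>k. {\<omega> \<in> space M. m \<le> k \<and> walk \<xi> k \<omega> \<le> y \<and> (\<forall>j\<in>{m..<k}. \<not> walk \<xi> j \<omega> \<le> y)})"
  define B where "B = {z :: real \<times> real. snd z \<le> K}"
  have B: "B \<in> sets borel"
  proof -
    have "{z \<in> space borel. snd z \<le> K} \<in> sets (borel :: (real \<times> real) measure)" by measurable
    then show ?thesis by (simp add: B_def)
  qed
  have F: "F k \<in> sets (past k)" for k
  proof -
    have w: "{\<omega> \<in> space (past k). walk \<xi> j \<omega> \<le> y} \<in> sets (past k)" if "j \<le> k" for j
      using measurable_walk_past[OF that] by measurable
    have "F k = (if m \<le> k then {\<omega> \<in> space (past k). walk \<xi> k \<omega> \<le> y} - (\<Union>j\<in>{m..<k}. {\<omega> \<in> space (past k). walk \<xi> j \<omega> \<le> y}) else {})"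
      by (auto simp: F_def)
    also have "\<dots> \<in> sets (past k)" using w by (auto intro!: sets.Diff sets.finite_UN)
    finally show ?thesis .
  qed
  have disj: "disjoint_family F"
  proof -
    have "F i \<inter> F j = {}" if "i < j" for i j using that by (auto simp: F_def)
    then show ?thesis unfolding disjoint_family_on_def by (metis inf_commute linorder_neqE_nat)
  qed
  have "(\<Union>k. F k) = {\<omega> \<in> space M. \<exists>k\<ge>m. walk \<xi> k \<omega> \<le> y}"
  proof (intro equalityI subsetI)
    fix \<omega> assume \<omega>: "\<omega> \<in> {\<omega> \<in> space M. \<exists>k\<ge>m. walk \<xi> k \<omega> \<le> y}"
    define k where "k = (LEAST k. m \<le> k \<and> walk \<xi> k \<omega> \<le> y)"
    from \<omega> have "\<exists>k. m \<le> k \<and> walk \<xi> k \<omega> \<le> y" by auto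
    then have "m \<le> k \<and> walk \<xi> k \<omega> \<le> y" unfolding k_def by (rule LeastI_ex)
    moreover have "\<not> (m \<le> j \<and> walk \<xi> j \<omega> \<le> y)" if "j < k" for j
      using that unfolding k_def by (rule not_less_Least)
    ultimately have "\<omega> \<in> F k" using \<omega> by (auto simp: F_def)
    then show "\<omega> \<in> (\<Union>k. F k)" by auto
  qed (auto simp: F_def)
  moreover have "prob (\<Union>k. F k \<inter> {\<omega> \<in> space M. X (Suc k) \<omega> \<in> B})
      \<le> prob {\<omega> \<in> space M. \<exists>n\<ge>m. perturbed_walk \<xi> \<eta> n \<omega> \<le> y + K}"
  proof (intro finite_measure_mono subsetI)
    fix \<omega> assume "\<omega> \<in> (\<Union>k. F k \<inter> {\<omega> \<in> space M. X (Suc k) \<omega> \<in> B})"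
    then obtain k where "\<omega> \<in> space M" "m \<le> k" "walk \<xi> k \<omega> \<le> y" "\<eta> (Suc k) \<omega> \<le> K"
      by (auto simp: F_def B_def)
    \<comment> \<open>The witness is \<open>Suc k\<close>, because the perturbed walk at
      \<open>Suc k\<close> is the walk at \<open>k\<close> plus
      \<open>\<eta> (Suc k)\<close>.\<close>
    then show "\<omega> \<in> {\<omega> \<in> space M. \<exists>n\<ge>m. perturbed_walk \<xi> \<eta> n \<omega> \<le> y + K}"
      by (auto simp: perturbed_walk_def intro!: exI[of _ "Suc k"])
  qed measurable
  ultimately show ?thesis
    using prob_disjoint_past_next[OF F disj B] by (simp add: B_def)
qed

text \<open>Fix \<open>K\<close> such that \<open>\<eta> 0 \<le> K\<close> has positive probability
  \<open>q\<close>; the tail probability of the walk at \<open>y\<close> is then at most that of the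
  perturbed walk at \<open>y + K\<close> divided by \<open>q\<close>.\<close>

lemma walk_diverges:
  assumes "positively_divergent M \<xi> \<eta>"
  shows "AE \<omega> in M. filterlim (\<lambda>n. walk \<xi> n \<omega>) at_top sequentially"
proof (rule AE_at_top_of_tail_prob)
  fix y
  obtain K where K: "0 < prob {\<omega> \<in> space M. \<eta> 0 \<omega> \<le> K}" using ex_prob_le_pos[of "\<eta> 0"] by auto
  let ?q = "prob {\<omega> \<in> space M. \<eta> 0 \<omega> \<le> K}"
  have lim: "(\<lambda>m. prob {\<omega> \<in> space M. \<exists>n\<ge>m. perturbed_walk \<xi> \<eta> n \<omega> \<le> y + K} / ?q) \<longlonglongrightarrow> 0 / ?q"
    using assms K unfolding positively_divergent_def
    by (intro tendsto_divide tail_prob_tendsto_0) auto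
  show "(\<lambda>m. prob {\<omega> \<in> space M. \<exists>n\<ge>m. walk \<xi> n \<omega> \<le> y}) \<longlonglongrightarrow> 0"
  proof (rule tendsto_sandwich[OF _ _ tendsto_const])
    show "\<forall>\<^sub>F m in sequentially. prob {\<omega> \<in> space M. \<exists>n\<ge>m. walk \<xi> n \<omega> \<le> y}
      \<le> prob {\<omega> \<in> space M. \<exists>n\<ge>m. perturbed_walk \<xi> \<eta> n \<omega> \<le> y + K} / ?q"
      using prob_walk_tail_le[of _ y K] K by (simp add: field_simps)
  qed (use lim in auto)
qed measurable

lemma prob_xi_pos:
  assumes "AE \<omega> in M. filterlim (\<lambda>n. walk \<xi> n \<omega>) at_top sequentially"
  shows "0 < prob {\<omega> \<in> space M. \<xi> 0 \<omega> > 0}"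
proof (rule ccontr)
  assume "\<not> ?thesis"
  then have "prob {\<omega> \<in> space M. \<xi> 0 \<omega> > 0} = 0" by (simp add: zero_less_measure_iff)
  moreover have "prob {\<omega> \<in> space M. \<xi> n \<omega> > 0} = prob {\<omega> \<in> space M. \<xi> 0 \<omega> > 0}" for n
  proof -
    have "{z \<in> space borel. fst z > 0} \<in> sets (borel :: (real \<times> real) measure)" by measurable
    from prob_X_eq[OF this, of n] show ?thesis by simp
  qed
  ultimately have "AE \<omega> in M. \<not> \<xi> n \<omega> > 0" for n
    using prob_eq_0[of "{\<omega> \<in> space M. \<xi> n \<omega> > 0}"] by simp
  then have "AE \<omega> in M. \<forall>n. \<not> \<xi> n \<omega> > 0" by (simp add: AE_all_countable)
  with assms have "AE \<omega> in M. False"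
  proof eventually_elim
    case (elim \<omega>)
    have "walk \<xi> n \<omega> \<le> 0" for n unfolding walk_def using elim(2) by (intro sum_nonpos) (auto simp: not_less)
    moreover have "\<forall>\<^sub>F n in sequentially. 0 < walk \<xi> n \<omega>"
      using elim(1) by (simp add: filterlim_at_top_dense)
    ultimately show False by (auto simp: eventually_sequentially not_less[symmetric])
  qed
  then show False by simp
qed

section \<open>Positivity of the mean\<close>

text \<open>Independence and centring annihilate the off-diagonal products.\<close>

lemma expectation_square_sum_centered:
  fixes f :: "real \<times> real \<Rightarrow> real"
  assumes [measurable]: "f \<in> borel_measurable borel"
    and bd: "\<And>z. \<bar>f z\<bar> \<le> C" and mean: "expectation (\<lambda>\<omega>. f (X 0 \<omega>)) = 0"
  shows "expectation (\<lambda>\<omega>. (\<Sum>i=1..N. f (X i \<omega>))\<^sup>2) \<le> N * C\<^sup>2"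
proof -
  have int: "integrable M (\<lambda>\<omega>. f (X i \<omega>))" for i
    by (intro integrable_const_bound[where B=C]) (use bd in auto)
  have int2: "integrable M (\<lambda>\<omega>. f (X i \<omega>) * f (X j \<omega>))" for i j
    by (intro integrable_const_bound[where B="C * C"])
      (use bd in \<open>auto simp: abs_mult intro!: mult_mono intro: order_trans[OF abs_ge_zero]\<close>)
  have ind: "indep_vars (\<lambda>_. borel) (\<lambda>i \<omega>. f (X i \<omega>)) UNIV"
    using indep by (rule indep_vars_compose2) auto
  have mean': "expectation (\<lambda>\<omega>. f (X i \<omega>)) = 0" for i using expectation_X_eq[of f i] mean by simp
  have cross: "expectation (\<lambda>\<omega>. f (X i \<omega>) * f (X j \<omega>)) = (if i = j then expectation (\<lambda>\<omega>. (f (X i \<omega>))\<^sup>2) else 0)" for i j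
  proof (cases "i = j")
    case False
    have "expectation (\<lambda>\<omega>. \<Prod>k\<in>{i,j}. f (X k \<omega>)) = (\<Prod>k\<in>{i,j}. expectation (\<lambda>\<omega>. f (X k \<omega>)))"
      by (rule indep_vars_lebesgue_integral) (use int in \<open>auto intro: indep_vars_subset[OF ind]\<close>)
    then show ?thesis using False mean' by simp
  qed (simp add: power2_eq_square)
  have "expectation (\<lambda>\<omega>. (\<Sum>i=1..N. f (X i \<omega>))\<^sup>2)
      = expectation (\<lambda>\<omega>. \<Sum>i=1..N. \<Sum>j=1..N. f (X i \<omega>) * f (X j \<omega>))"
    by (simp add: power2_eq_square sum_product)
  also have "\<dots> = (\<Sum>i=1..N. \<Sum>j=1..N. expectation (\<lambda>\<omega>. f (X i \<omega>) * f (X j \<omega>)))"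
    using int2 by (simp add: Bochner_Integration.integral_sum Bochner_Integration.integrable_sum)
  also have "\<dots> = (\<Sum>i=1..N. expectation (\<lambda>\<omega>. (f (X i \<omega>))\<^sup>2))"
    unfolding cross by simp
  also have "\<dots> \<le> (\<Sum>i=1..N. C\<^sup>2)"
  proof (rule sum_mono)
    fix i
    have "expectation (\<lambda>\<omega>. (f (X i \<omega>))\<^sup>2) \<le> expectation (\<lambda>\<omega>. C\<^sup>2)"
    proof (rule integral_mono)
      show "integrable M (\<lambda>\<omega>. (f (X i \<omega>))\<^sup>2)" using int2[of i i] by (simp add: power2_eq_square)
      show "(f (X i \<omega>))\<^sup>2 \<le> C\<^sup>2" for \<omega>
        using bd[of "X i \<omega>"] by (simp add: abs_le_square_iff[symmetric] order_trans[OF _ abs_ge_self])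
    qed auto
    then show "expectation (\<lambda>\<omega>. (f (X i \<omega>))\<^sup>2) \<le> C\<^sup>2" by (simp add: prob_space)
  qed
  finally show ?thesis by simp
qed

text \<open>A one-sided law of large numbers in mean. Truncation at \<open>R\<close> leaves a
  remainder \<open>v\<close> of mean at most \<open>e / 4\<close>, the truncated mean
  \<open>m\<close> is also at most \<open>e / 4\<close>, and the centred bounded part fluctuates
  only like the square root of \<open>N\<close>.\<close>

lemma expectation_walk_pos_part_le:
  assumes int: "integrable M (\<xi> 0)" and mean: "expectation (\<xi> 0) \<le> 0" and e: "0 < e"
  shows "\<exists>C. \<forall>N\<ge>1. expectation (\<lambda>\<omega>. max (walk \<xi> N \<omega>) 0) \<le> C + e * real N"
proof -
  have int': "integrable M (\<xi> n)" for n using integrable_X_iff[of fst n] int by simp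
  have "(\<lambda>n. expectation (\<lambda>\<omega>. \<bar>\<xi> 0 \<omega> - clamp_real (real n) (\<xi> 0 \<omega>)\<bar>)) \<longlonglongrightarrow> expectation (\<lambda>\<omega>. 0)"
  proof (rule integral_dominated_convergence[where w="\<lambda>\<omega>. \<bar>\<xi> 0 \<omega>\<bar>"])
    show "AE \<omega> in M. (\<lambda>n. \<bar>\<xi> 0 \<omega> - clamp_real (real n) (\<xi> 0 \<omega>)\<bar>) \<longlonglongrightarrow> 0"
    proof (intro AE_I2 tendsto_eventually)
      fix \<omega>
      obtain m :: nat where m: "\<bar>\<xi> 0 \<omega>\<bar> \<le> real m" using real_arch_simple by blast
      show "\<forall>\<^sub>F n in sequentially. \<bar>\<xi> 0 \<omega> - clamp_real (real n) (\<xi> 0 \<omega>)\<bar> = 0"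
        using eventually_ge_at_top[of m]
      proof eventually_elim
        case (elim n)
        then have "\<bar>\<xi> 0 \<omega>\<bar> \<le> real n" using m by simp
        then show ?case by (simp add: clamp_real_def abs_le_iff)
      qed
    qed
  qed (use int in \<open>auto simp: clamp_real_def\<close>)
  then have "\<forall>\<^sub>F n in sequentially. expectation (\<lambda>\<omega>. \<bar>\<xi> 0 \<omega> - clamp_real (real n) (\<xi> 0 \<omega>)\<bar>) < e / 4"
    using e by (intro order_tendstoD(2)[where y=0]) auto
  then obtain R :: nat where R: "expectation (\<lambda>\<omega>. \<bar>\<xi> 0 \<omega> - clamp_real (real R) (\<xi> 0 \<omega>)\<bar>) < e / 4"
    by (auto simp: eventually_sequentially)
  define u where "u = clamp_real (real R)"
  have [measurable]: "u \<in> borel_measurable borel" unfolding u_def by simp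
  have u: "\<bar>u t\<bar> \<le> R" for t unfolding u_def by (rule abs_clamp_real_le) simp
  have iu: "integrable M (\<lambda>\<omega>. u (\<xi> n \<omega>))" for n by (intro integrable_const_bound[where B=R]) (use u in auto)
  define m where "m = expectation (\<lambda>\<omega>. u (\<xi> 0 \<omega>))"
  have mR: "\<bar>m\<bar> \<le> R"
  proof -
    have "expectation (\<lambda>\<omega>. \<bar>u (\<xi> 0 \<omega>)\<bar>) \<le> expectation (\<lambda>_. real R)"
      using iu u by (intro integral_mono) auto
    then show ?thesis
      using integral_abs_bound[of M "\<lambda>\<omega>. u (\<xi> 0 \<omega>)"] unfolding m_def
      by (simp add: prob_space del: integral_abs_bound)
  qed
  have "- expectation (\<lambda>\<omega>. \<xi> 0 \<omega> - u (\<xi> 0 \<omega>)) \<le> e / 4"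
    using R integral_abs_bound[of M "\<lambda>\<omega>. \<xi> 0 \<omega> - u (\<xi> 0 \<omega>)"] unfolding u_def by linarith
  then have m4: "m \<le> e / 4" using mean int iu by (simp add: m_def)
  define c where "c = (\<lambda>i \<omega>. u (\<xi> i \<omega>) - m)"
  define v where "v = (\<lambda>i \<omega>. \<bar>\<xi> i \<omega> - u (\<xi> i \<omega>)\<bar>)"
  have [measurable]: "c i \<in> borel_measurable M" "v i \<in> borel_measurable M" for i unfolding c_def v_def by measurable
  have ic: "integrable M (c i)" for i unfolding c_def using iu by simp
  have iv: "integrable M (v i)" for i unfolding v_def using iu int' by simp
  have Ev: "expectation (v i) \<le> e / 4" for i
    using expectation_X_eq[of "\<lambda>z. \<bar>fst z - u (fst z)\<bar>" i] R by (simp add: v_def u_def)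
  have cR: "\<bar>u t - m\<bar> \<le> 2 * R" for t using u[of t] mR by linarith
  have isq: "integrable M (\<lambda>\<omega>. (\<Sum>i=1..N. c i \<omega>)\<^sup>2)" for N
  proof (intro integrable_const_bound[where B="(\<Sum>i=1..N. 2 * real R)\<^sup>2"] AE_I2)
    fix \<omega>
    have "\<bar>\<Sum>i=1..N. c i \<omega>\<bar> \<le> (\<Sum>i=1..N. 2 * real R)"
      by (rule order_trans[OF sum_abs]) (intro sum_mono, use cR in \<open>auto simp: c_def\<close>)
    then have "\<bar>\<Sum>i=1..N. c i \<omega>\<bar>\<^sup>2 \<le> (\<Sum>i=1..N. 2 * real R)\<^sup>2" by (intro power_mono) auto
    then show "norm ((\<Sum>i=1..N. c i \<omega>)\<^sup>2) \<le> (\<Sum>i=1..N. 2 * real R)\<^sup>2" by simp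
  qed measurable
  have Esq: "expectation (\<lambda>\<omega>. (\<Sum>i=1..N. c i \<omega>)\<^sup>2) \<le> N * (2 * real R)\<^sup>2" for N
    using expectation_square_sum_centered[of "\<lambda>z. u (fst z) - m" "2 * real R" N] cR iu
    by (simp add: c_def m_def prob_space)
  have "expectation (\<lambda>\<omega>. max (walk \<xi> N \<omega>) 0) \<le> 4 * (real R)\<^sup>2 / e + e * real N" if N: "N \<ge> 1" for N
  proof -
    have "expectation (\<lambda>\<omega>. max (walk \<xi> N \<omega>) 0)
      \<le> expectation (\<lambda>\<omega>. (e * N / 4 + (\<Sum>i=1..N. c i \<omega>)\<^sup>2 / (e * N)) + N * e / 4 + (\<Sum>i=1..N. v i \<omega>))"
    proof (rule integral_mono)
      show "integrable M (\<lambda>\<omega>. max (walk \<xi> N \<omega>) 0)"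
        unfolding walk_def using int' by (intro integrable_max Bochner_Integration.integrable_sum) auto
      show "integrable M (\<lambda>\<omega>. (e * N / 4 + (\<Sum>i=1..N. c i \<omega>)\<^sup>2 / (e * N)) + N * e / 4 + (\<Sum>i=1..N. v i \<omega>))"
        using isq iv by (intro Bochner_Integration.integrable_add Bochner_Integration.integrable_sum) auto
      fix \<omega>
      define s where "s = (\<Sum>i=1..N. c i \<omega>)"
      have "walk \<xi> N \<omega> \<le> (\<Sum>i=1..N. c i \<omega> + m + v i \<omega>)"
        unfolding walk_def by (intro sum_mono) (auto simp: c_def v_def)
      also have "\<dots> = s + N * m + (\<Sum>i=1..N. v i \<omega>)" by (simp add: sum.distrib s_def)
      finally have w: "walk \<xi> N \<omega> \<le> s + N * m + (\<Sum>i=1..N. v i \<omega>)" .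
      have "N * m \<le> e * N / 4" using mult_left_mono[OF m4, of "real N"] by (simp add: mult.commute)
      \<comment> \<open>Young's inequality with weight \<open>e * N\<close>: the expectation of
        \<open>s\<^sup>2\<close> is of order \<open>N\<close>, so the quadratic term contributes
        only a constant.\<close>
      moreover have "s \<le> e * N / 4 + s\<^sup>2 / (e * N)"
      proof -
        have "0 \<le> (e * N / 2 - s)\<^sup>2 / (e * N)" using e by simp
        also have "\<dots> = e * N / 4 + s\<^sup>2 / (e * N) - s"
          using e N by (simp add: power2_eq_square field_simps)
        finally show ?thesis by simp
      qed
      moreover have "0 \<le> (\<Sum>i=1..N. v i \<omega>)" by (intro sum_nonneg) (auto simp: v_def)
      moreover have "0 \<le> e * N / 4 + s\<^sup>2 / (e * N)" using e by simp
      ultimately show "max (walk \<xi> N \<omega>) 0 \<le> (e * N / 4 + (\<Sum>i=1..N. c i \<omega>)\<^sup>2 / (e * N)) + N * e / 4 + (\<Sum>i=1..N. v i \<omega>)"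
        using w e unfolding s_def[symmetric] by (simp add: mult.commute)
    qed
    also have "\<dots> = e * N / 4 + expectation (\<lambda>\<omega>. (\<Sum>i=1..N. c i \<omega>)\<^sup>2) / (e * N) + N * e / 4 + (\<Sum>i=1..N. expectation (v i))"
      using isq iv by (simp add: prob_space Bochner_Integration.integral_sum Bochner_Integration.integrable_sum)
    also have "\<dots> \<le> e * N / 4 + (N * (2 * real R)\<^sup>2) / (e * N) + N * e / 4 + (\<Sum>i=1..N. e / 4)"
      using Esq Ev e by (intro add_mono divide_right_mono sum_mono) auto
    also have "\<dots> \<le> 4 * (real R)\<^sup>2 / e + e * real N" using e N by (simp add: field_simps power2_eq_square)
    finally show ?thesis .
  qed
  then show ?thesis by blast
qed

text \<open>The law of an i.i.d. sequence is a product of equal factors, hence invariant under the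
  injective reindexing by \<open>k + i\<close>.\<close>

lemma distr_shift:
  "distr M (\<Pi>\<^sub>M i\<in>UNIV. borel) (\<lambda>\<omega> i. X (k + i) \<omega>) = (\<Pi>\<^sub>M i\<in>UNIV. distr M borel (X 0))"
proof -
  interpret N: prob_space "distr M borel (X 0)" by (rule prob_space_distr) measurable
  have m: "(\<lambda>\<omega> i. X i \<omega>) \<in> measurable M (\<Pi>\<^sub>M i\<in>UNIV. borel)"
    "(\<lambda>f i. f (k + i)) \<in> measurable (\<Pi>\<^sub>M i\<in>UNIV. borel) (\<Pi>\<^sub>M i\<in>UNIV. borel :: (real \<times> real) measure)"
    by (rule measurable_PiM_single'; auto)+
  have "distr M (\<Pi>\<^sub>M i\<in>UNIV. borel) (\<lambda>\<omega>. \<lambda>i\<in>UNIV. X i \<omega>) = (\<Pi>\<^sub>M i\<in>UNIV. distr M borel (X i))"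
    using indep by (subst (asm) indep_vars_iff_distr_eq_PiM) auto
  also have "(\<lambda>i. distr M borel (X i)) = (\<lambda>_. distr M borel (X 0))" by (rule ext) (rule distr_X)
  finally have P: "(\<Pi>\<^sub>M i\<in>UNIV. distr M borel (X 0)) = distr M (\<Pi>\<^sub>M i\<in>UNIV. borel) (\<lambda>\<omega> i. X i \<omega>)"
    by simp
  have "distr (\<Pi>\<^sub>M i\<in>UNIV. distr M borel (X 0)) (\<Pi>\<^sub>M i\<in>UNIV. borel) (\<lambda>f i. f (k + i))
    = distr (\<Pi>\<^sub>M i\<in>UNIV. distr M borel (X 0)) (\<Pi>\<^sub>M i\<in>UNIV. distr M borel (X 0)) (\<lambda>f. \<lambda>i\<in>UNIV. f (k + i))"
    by (intro distr_cong sets_PiM_cong) auto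
  also have "\<dots> = (\<Pi>\<^sub>M i\<in>UNIV. distr M borel (X 0))"
    by (rule distr_PiM_reindex[where f="\<lambda>i. k + i"]) (auto intro: N.prob_space_axioms)
  finally show ?thesis
    unfolding P distr_distr[OF m(2,1)] by (simp add: comp_def)
qed

lemma walk_diff: "walk \<xi> (k + i) \<omega> - walk \<xi> k \<omega> = (\<Sum>l=1..i. \<xi> (k + l) \<omega>)"
proof -
  have "walk \<xi> (k + i) \<omega> = walk \<xi> k \<omega> + (\<Sum>l=k+1..k+i. \<xi> l \<omega>)"
    unfolding walk_def using sum.ub_add_nat[of 1 k "\<lambda>l. \<xi> l \<omega>" i] by simp
  also have "(\<Sum>l=k+1..k+i. \<xi> l \<omega>) = (\<Sum>l=1..i. \<xi> (k + l) \<omega>)"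
    using sum.shift_bounds_cl_nat_ivl[of "\<lambda>l. \<xi> l \<omega>" 1 k i] by (simp add: add.commute)
  finally show ?thesis by simp
qed

text \<open>Time \<open>k\<close> is a future minimum of the walk. The margin
  \<open>\<epsilon>\<close> gives every such time a fixed share in the growth, as is needed for a
  linear lower bound.\<close>

definition rises :: "real \<Rightarrow> nat \<Rightarrow> 'a set" where
  "rises \<epsilon> k = {\<omega> \<in> space M. \<forall>j>k. walk \<xi> k \<omega> + \<epsilon> \<le> walk \<xi> j \<omega>}"

lemma sets_rises [measurable]: "rises \<epsilon> k \<in> events"
  unfolding rises_def by measurable

lemma prob_rises: "prob (rises \<epsilon> k) = prob (rises \<epsilon> 0)"
proof -
  define Q where "Q = {f \<in> space (\<Pi>\<^sub>M i\<in>UNIV. borel :: (real \<times> real) measure). \<forall>i. \<epsilon> \<le> (\<Sum>l=1..Suc i. fst (f l :: real \<times> real))}"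
  have Q: "Q \<in> sets (\<Pi>\<^sub>M i\<in>UNIV. borel)" unfolding Q_def by measurable
  have "prob (rises \<epsilon> k) = measure (\<Pi>\<^sub>M i\<in>UNIV. distr M borel (X 0)) Q" for k
  proof -
    have m: "(\<lambda>\<omega> i. X (k + i) \<omega>) \<in> measurable M (\<Pi>\<^sub>M i\<in>UNIV. borel)" by (rule measurable_PiM_single') auto
    have "rises \<epsilon> k = (\<lambda>\<omega> i. X (k + i) \<omega>) -` Q \<inter> space M"
    proof -
      have "(\<forall>j>k. walk \<xi> k \<omega> + \<epsilon> \<le> walk \<xi> j \<omega>) \<longleftrightarrow> (\<forall>i. \<epsilon> \<le> (\<Sum>l=1..Suc i. \<xi> (k + l) \<omega>))" for \<omega>
      proof -
        have "(\<forall>j>k. walk \<xi> k \<omega> + \<epsilon> \<le> walk \<xi> j \<omega>) \<longleftrightarrow> (\<forall>i. walk \<xi> k \<omega> + \<epsilon> \<le> walk \<xi> (k + Suc i) \<omega>)"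
          by (metis less_iff_Suc_add add_Suc_right)
        also have "\<dots> \<longleftrightarrow> (\<forall>i. \<epsilon> \<le> walk \<xi> (k + Suc i) \<omega> - walk \<xi> k \<omega>)" by (simp add: algebra_simps)
        finally show ?thesis unfolding walk_diff .
      qed
      then show ?thesis unfolding rises_def Q_def by (auto simp: space_PiM)
    qed
    then show ?thesis using measure_distr[OF m Q] distr_shift[of k] by simp
  qed
  then show ?thesis by simp
qed

text \<open>If all these events were null, then almost surely every time would be followed by a
  later one at which the walk is no higher. Iteration from the value 0 at time 0 yields arbitrarily
  late times with \<open>walk \<xi> j \<omega> \<le> 0\<close>, against divergence.\<close>

lemma prob_rises_pos:
  assumes div: "AE \<omega> in M. filterlim (\<lambda>n. walk \<xi> n \<omega>) at_top sequentially"
  shows "\<exists>\<epsilon>>0. 0 < prob (rises \<epsilon> 0)"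
proof (rule ccontr)
  assume "\<not> ?thesis"
  then have "prob (rises (1 / real (Suc m)) k) = 0" for m k
    unfolding prob_rises[of _ k] by (simp add: zero_less_measure_iff)
  then have "AE \<omega> in M. \<omega> \<notin> rises (1 / real (Suc m)) k" for m k
    using prob_eq_0[OF sets_rises] by simp
  then have "AE \<omega> in M. \<forall>m k. \<omega> \<notin> rises (1 / real (Suc m)) k" by (simp add: AE_all_countable)
  with div AE_space have "AE \<omega> in M. False"
  proof eventually_elim
    case (elim \<omega>)
    have "\<exists>j>k. walk \<xi> j \<omega> \<le> walk \<xi> k \<omega>" for k
    proof (rule ccontr)
      assume *: "\<not> (\<exists>j>k. walk \<xi> j \<omega> \<le> walk \<xi> k \<omega>)"
      have "\<forall>\<^sub>F n in sequentially. walk \<xi> k \<omega> + 1 \<le> walk \<xi> n \<omega>"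
        using elim(1) by (simp add: filterlim_at_top)
      then obtain n0 where n0: "\<And>n. n \<ge> n0 \<Longrightarrow> walk \<xi> k \<omega> + 1 \<le> walk \<xi> n \<omega>"
        by (auto simp: eventually_sequentially)
      \<comment> \<open>From \<open>n0\<close> on the gain is at least 1, so the minimum of this
        finite set bounds all gains after time \<open>k\<close>.\<close>
      define D where "D = insert 1 ((\<lambda>j. walk \<xi> j \<omega> - walk \<xi> k \<omega>) ` {k<..<n0})"
      have D: "finite D" "D \<noteq> {}" "\<And>d. d \<in> D \<Longrightarrow> 0 < d" using * by (auto simp: D_def not_le)
      then have "0 < Min D" by simp
      then obtain m where m: "1 / real (Suc m) < Min D" using nat_approx_posE by blast
      have "walk \<xi> k \<omega> + 1 / real (Suc m) \<le> walk \<xi> j \<omega>" if "j > k" for j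
      proof (cases "j < n0")
        case True
        then have "walk \<xi> j \<omega> - walk \<xi> k \<omega> \<in> D" using that by (auto simp: D_def)
        then have "Min D \<le> walk \<xi> j \<omega> - walk \<xi> k \<omega>" using D by (intro Min_le)
        then show ?thesis using m by linarith
      next
        case False
        moreover have "1 / real (Suc m) \<le> 1" by simp
        ultimately show ?thesis using n0[of j] by linarith
      qed
      then have "\<omega> \<in> rises (1 / real (Suc m)) k" using elim(2) by (simp add: rises_def)
      then show False using elim(3) by blast
    qed note desc = this
    have "\<exists>j\<ge>n. walk \<xi> j \<omega> \<le> 0" for n
    proof (induction n)
      case 0 show ?case by (rule exI[of _ 0]) (simp add: walk_def)
    next
      case (Suc n)
      then obtain j where "j \<ge> n" "walk \<xi> j \<omega> \<le> 0" by auto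
      moreover obtain i where "i > j" "walk \<xi> i \<omega> \<le> walk \<xi> j \<omega>" using desc by blast
      ultimately show ?case by (intro exI[of _ i]) auto
    qed
    moreover have "\<forall>\<^sub>F n in sequentially. 0 < walk \<xi> n \<omega>"
      using elim(1) by (simp add: filterlim_at_top_dense)
    ultimately show False by (auto simp: eventually_sequentially not_less[symmetric])
  qed
  then show False by simp
qed

text \<open>
  The walk stays above \<open>S\<^sub>k + \<epsilon>\<close> for ever after time \<open>k\<close> with a probability \<open>\<delta> > 0\<close> independent of \<open>k\<close>, and
  \<open>\<epsilon>\<close> times the number of such \<open>k < N\<close> bounds \<open>S\<^sub>N\<close> from below, up to the finite overall minimum. So \<open>S\<^sub>N\<close> grows linearly, which needs a positive mean.
\<close>
lemma expectation_xi_pos: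
  assumes div: "AE \<omega> in M. filterlim (\<lambda>n. walk \<xi> n \<omega>) at_top sequentially"
    and int: "integrable M (\<xi> 0)"
  shows "0 < expectation (\<xi> 0)"
proof (rule ccontr)
  assume mean: "\<not> ?thesis"
  obtain \<epsilon> where \<epsilon>: "0 < \<epsilon>" "0 < prob (rises \<epsilon> 0)" using prob_rises_pos[OF div] by auto
  define \<delta> where "\<delta> = prob (rises \<epsilon> 0)"
  have \<delta>: "0 < \<delta>" using \<epsilon> by (simp add: \<delta>_def)
  \<comment> \<open>The walk ever falls below \<open>- K\<close>: outside this event its overall
    minimum costs only a constant.\<close>
  define B where "B = (\<lambda>K::nat. {\<omega> \<in> space M. \<exists>n. walk \<xi> n \<omega> < - real K})"
  have [measurable]: "B K \<in> events" for K unfolding B_def by measurable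
  have "(\<lambda>K. prob (B K)) \<longlonglongrightarrow> prob (\<Inter>K. B K)"
  proof (intro finite_Lim_measure_decseq)
    have "x < - real m" if "m \<le> n" "x < - real n" for x and m n :: nat
      using that by linarith
    then show "decseq B" unfolding decseq_def B_def by blast
  qed auto
  moreover have "AE \<omega> in M. \<omega> \<notin> (\<Inter>K. B K)"
    using div
  proof eventually_elim
    case (elim \<omega>)
    have "\<forall>\<^sub>F n in sequentially. 0 < walk \<xi> n \<omega>" using elim by (simp add: filterlim_at_top_dense)
    then obtain m where m: "\<And>n. n \<ge> m \<Longrightarrow> 0 < walk \<xi> n \<omega>" by (auto simp: eventually_sequentially)
    obtain K :: nat where K: "(\<Sum>n<m. \<bar>walk \<xi> n \<omega>\<bar>) \<le> real K" using real_arch_simple by blast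
    have "- real K \<le> walk \<xi> n \<omega>" for n
    proof (cases "n < m")
      case True
      then have "\<bar>walk \<xi> n \<omega>\<bar> \<le> (\<Sum>n<m. \<bar>walk \<xi> n \<omega>\<bar>)" by (intro member_le_sum) auto
      then show ?thesis using K by linarith
    qed (use m[of n] in auto)
    then have "\<omega> \<notin> B K" by (auto simp: B_def not_less)
    then show ?case by blast
  qed
  then have "prob (\<Inter>K. B K) = 0" by (subst prob_eq_0) auto
  ultimately have "(\<lambda>K. prob (B K)) \<longlonglongrightarrow> 0" by simp
  then have "\<forall>\<^sub>F K in sequentially. prob (B K) < \<delta> / 4" using \<delta> by (intro order_tendstoD(2)) auto
  then obtain K where K: "prob (B K) < \<delta> / 4" by (auto simp: eventually_sequentially)
  \<comment> \<open>The expected count grows at rate \<open>\<epsilon> * \<delta>\<close>. The slack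
    \<open>\<epsilon> * \<delta> / 4\<close> allowed here and the same amount lost on
    \<open>B K\<close> leave half of that rate for the contradiction.\<close>
  obtain C where C: "\<And>N. N \<ge> 1 \<Longrightarrow> expectation (\<lambda>\<omega>. max (walk \<xi> N \<omega>) 0) \<le> C + \<epsilon> * \<delta> / 4 * real N"
    using expectation_walk_pos_part_le[OF int, of "\<epsilon> * \<delta> / 4"] mean \<epsilon> \<delta> by auto
  define G where "G = (\<lambda>N \<omega>. \<epsilon> * (\<Sum>k<N. indicator (rises \<epsilon> k) \<omega>))"
  \<comment> \<open>The bound is stated for all \<open>n \<ge> N\<close>, so that the induction also
    passes a time \<open>N\<close> that is not a future minimum.\<close>
  have count: "\<forall>n\<ge>N. G N \<omega> - K \<le> walk \<xi> n \<omega>" if \<omega>: "\<omega> \<in> space M - B K" for N \<omega>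
  proof (induction N)
    case 0 then show ?case using \<omega> by (auto simp: G_def B_def not_less)
  next
    case (Suc N)
    show ?case
    proof (intro allI impI)
      fix n assume n: "Suc N \<le> n"
      show "G (Suc N) \<omega> - K \<le> walk \<xi> n \<omega>"
      proof (cases "\<omega> \<in> rises \<epsilon> N")
        case True
        then have "walk \<xi> N \<omega> + \<epsilon> \<le> walk \<xi> n \<omega>" using n by (auto simp: rises_def)
        moreover have "G N \<omega> - K \<le> walk \<xi> N \<omega>" using Suc by simp
        moreover have "G (Suc N) \<omega> = G N \<omega> + \<epsilon>" using True by (simp add: G_def algebra_simps)
        ultimately show ?thesis by linarith
      next
        case False
        then have "G (Suc N) \<omega> = G N \<omega>" by (simp add: G_def)
        then show ?thesis using Suc n by simp
      qed
    qed
  qed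
  have "real N * (\<epsilon> * \<delta> / 2) \<le> C + K" if N: "N \<ge> 1" for N
  proof -
    have iw: "integrable M (\<lambda>\<omega>. max (walk \<xi> N \<omega>) 0)"
      unfolding walk_def using integrable_X_iff[of fst] int
      by (intro integrable_max Bochner_Integration.integrable_sum) auto
    have "expectation (G N) \<le> expectation (\<lambda>\<omega>. max (walk \<xi> N \<omega>) 0 + K + \<epsilon> * N * indicator (B K) \<omega>)"
    proof (rule integral_mono)
      show "integrable M (G N)" unfolding G_def
        by (intro integrable_mult_right Bochner_Integration.integrable_sum integrable_real_indicator) (auto simp: emeasure_eq_measure)
      show "integrable M (\<lambda>\<omega>. max (walk \<xi> N \<omega>) 0 + K + \<epsilon> * N * indicator (B K) \<omega>)"
        using iw by (intro Bochner_Integration.integrable_add integrable_mult_right integrable_real_indicator) (auto simp: emeasure_eq_measure)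
      fix \<omega> assume \<omega>: "\<omega> \<in> space M"
      show "G N \<omega> \<le> max (walk \<xi> N \<omega>) 0 + K + \<epsilon> * N * indicator (B K) \<omega>"
      proof (cases "\<omega> \<in> B K")
        case True
        have "(\<Sum>k<N. indicator (rises \<epsilon> k) \<omega>) \<le> (\<Sum>k<N. 1::real)" by (intro sum_mono) (simp add: indicator_def)
        then have "G N \<omega> \<le> \<epsilon> * N" using \<epsilon> unfolding G_def by (intro mult_left_mono) auto
        then show ?thesis using True by simp
      next
        case False
        then have "G N \<omega> - K \<le> walk \<xi> N \<omega>" using count[of \<omega> N] \<omega> by auto
        then show ?thesis using False by simp
      qed
    qed
    also have "\<dots> = expectation (\<lambda>\<omega>. max (walk \<xi> N \<omega>) 0) + K + \<epsilon> * N * prob (B K)"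
      using iw by (simp add: prob_space integrable_real_indicator emeasure_eq_measure)
    also have "\<dots> \<le> (C + \<epsilon> * \<delta> / 4 * real N) + K + \<epsilon> * N * (\<delta> / 4)"
      using C[OF N] K \<epsilon> by (intro add_mono mult_left_mono) auto
    also have "expectation (G N) = \<epsilon> * (N * \<delta>)"
    proof -
      have "expectation (G N) = \<epsilon> * (\<Sum>k<N. prob (rises \<epsilon> k))" unfolding G_def
        by (simp add: Bochner_Integration.integral_sum integrable_real_indicator emeasure_eq_measure)
      also have "(\<Sum>k<N. prob (rises \<epsilon> k)) = (\<Sum>k<N. \<delta>)"
        unfolding \<delta>_def by (intro sum.cong refl prob_rises)
      finally show ?thesis by simp
    qed
    finally show ?thesis by (simp add: algebra_simps)
  qed
  moreover obtain N :: nat where "(C + K) / (\<epsilon> * \<delta> / 2) < N" using reals_Archimedean2 by blast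
  moreover from this have "C + K < max 1 N * (\<epsilon> * \<delta> / 2)"
  proof -
    assume "(C + K) / (\<epsilon> * \<delta> / 2) < N"
    then have "C + K < N * (\<epsilon> * \<delta> / 2)" using \<epsilon> \<delta> by (subst (asm) pos_divide_less_eq) auto
    also have "\<dots> \<le> max 1 N * (\<epsilon> * \<delta> / 2)" using \<epsilon> \<delta> by (intro mult_right_mono) auto
    finally show ?thesis .
  qed
  ultimately show False by (meson max.cobounded1 not_less)
qed

end

section \<open>Necessity of the moment conditions\<close>

lemma finite_le_if_at_top:
  fixes f :: "nat \<Rightarrow> real"
  assumes "filterlim f at_top sequentially"
  shows "finite {n. f n \<le> x}"
proof -
  have "\<forall>\<^sub>F n in sequentially. x < f n" using assms by (simp add: filterlim_at_top_dense)
  then have "\<forall>\<^sub>F n in cofinite. \<not> f n \<le> x"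
    unfolding cofinite_eq_sequentially by eventually_elim simp
  then show ?thesis by (simp add: eventually_cofinite)
qed

text \<open>Along a divergent path the supremum is attained unless its index set is empty;
  \<open>insert 0\<close> carries the convention for the empty set.\<close>

lemma last_exit_eq_Max:
  assumes "finite {n. perturbed_walk \<xi> \<eta> n \<omega> \<le> x}"
  shows "last_exit \<xi> \<eta> x \<omega> = of_nat (Max (insert 0 {n. 1 \<le> n \<and> perturbed_walk \<xi> \<eta> n \<omega> \<le> x}))"
proof -
  let ?A = "{n. 1 \<le> n \<and> perturbed_walk \<xi> \<eta> n \<omega> \<le> x}"
  have fin: "finite ?A" by (rule finite_subset[OF _ assms]) auto
  show ?thesis unfolding last_exit_def
  proof (rule antisym)
    show "(SUP n\<in>?A. of_nat n) \<le> (of_nat (Max (insert 0 ?A)) :: ennreal)"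
      using fin by (intro SUP_least of_nat_mono Max_ge) auto
    have "Max (insert 0 ?A) \<in> insert 0 ?A" using fin by (intro Max_in) auto
    then show "of_nat (Max (insert 0 ?A)) \<le> (SUP n\<in>?A. of_nat n :: ennreal)"
    proof (rule insertE)
      assume "Max (insert 0 ?A) \<in> ?A" then show ?thesis by (rule SUP_upper)
    qed simp
  qed
qed

lemma perturbed_walk_self: "1 \<le> n \<Longrightarrow> perturbed_walk \<xi> \<xi> n \<omega> = walk \<xi> n \<omega>"
  by (cases n) (simp_all add: perturbed_walk_def walk_def)

lemma last_exit_walk_eq: "last_exit_walk \<xi> y \<omega> = last_exit \<xi> \<xi> y \<omega>"
  unfolding last_exit_walk_def last_exit_def
proof (rule antisym)
  show "(SUP n\<in>{n. walk \<xi> n \<omega> \<le> y}. of_nat n :: ennreal) \<le> (SUP n\<in>{n. 1 \<le> n \<and> perturbed_walk \<xi> \<xi> n \<omega> \<le> y}. of_nat n)"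
  proof (rule SUP_least)
    fix n assume "n \<in> {n. walk \<xi> n \<omega> \<le> y}"
    then show "of_nat n \<le> (SUP n\<in>{n. 1 \<le> n \<and> perturbed_walk \<xi> \<xi> n \<omega> \<le> y}. of_nat n :: ennreal)"
      \<comment> \<open>Index 0 may belong to the left-hand index set only, but it contributes the
        value 0.\<close>
      by (cases "n = 0") (auto simp: perturbed_walk_self intro!: SUP_upper)
  qed
  show "(SUP n\<in>{n. 1 \<le> n \<and> perturbed_walk \<xi> \<xi> n \<omega> \<le> y}. of_nat n) \<le> (SUP n\<in>{n. walk \<xi> n \<omega> \<le> y}. of_nat n :: ennreal)"
    by (rule SUP_subset_mono) (auto simp: perturbed_walk_self)
qed

lemma ennreal_powr_of_nat: "ennreal_powr (of_nat n) p = ennreal (real n powr p)"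
  by (simp add: ennreal_powr_def)

section \<open>Moments of last exit times as dyadic sums\<close>

context prob_space
begin

text \<open>For divergent \<open>f\<close>, up to constants the moment of order \<open>p\<close> of
  the last index with \<open>f n \<le> x\<close>: that index is at least \<open>2 ^ k\<close>
  exactly on the event shown. In this form the inequalities between tail probabilities apply term by
  term.\<close>

definition dyadic_tail_sum :: "(nat \<Rightarrow> 'a \<Rightarrow> real) \<Rightarrow> real \<Rightarrow> real \<Rightarrow> ennreal" where
  "dyadic_tail_sum f p x = (\<Sum>k. ennreal ((2 ^ k) powr p) * emeasure M {\<omega> \<in> space M. \<exists>n\<ge>2 ^ k. f n \<omega> \<le> x})"

end

context perturbed_random_walk
begin

text \<open>The components of a pair may be dependent in any way, so equal components are
  admissible.\<close>

lemma self_perturbed: "perturbed_random_walk M \<xi> \<xi>"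
proof unfold_locales
  have d[measurable]: "(\<lambda>z. (fst z, fst z)) \<in> borel_measurable (borel :: (real \<times> real) measure)"
    by (intro borel_measurable_Pair) auto
  show "indep_vars (\<lambda>_. borel) (\<lambda>n \<omega>. (\<xi> n \<omega>, \<xi> n \<omega>)) UNIV"
    using indep_vars_compose2[OF indep, of "\<lambda>_ z. (fst z, fst z)" "\<lambda>_. borel"] d by simp
  show "distr M borel (\<lambda>\<omega>. (\<xi> n \<omega>, \<xi> n \<omega>)) = distr M borel (\<lambda>\<omega>. (\<xi> 0 \<omega>, \<xi> 0 \<omega>))" for n
    using distr_distr[OF d measurable_X[of n]] distr_distr[OF d measurable_X[of 0]] distr_X[of n]
    by (simp add: comp_def)
qed (rule xi_nondegenerate)+

lemma dyadic_tail_sum_finite: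
  assumes div: "positively_divergent M \<xi> \<eta>" and p: "p > 0"
    and fin: "(\<integral>\<^sup>+\<omega>. ennreal_powr (last_exit \<xi> \<eta> x \<omega>) p \<partial>M) < \<infinity>"
  shows "dyadic_tail_sum (perturbed_walk \<xi> \<eta>) p x < \<infinity>"
proof -
  let ?T = "\<lambda>k. {\<omega> \<in> space M. \<exists>n\<ge>2 ^ k. perturbed_walk \<xi> \<eta> n \<omega> \<le> x}"
  define C where "C = 2 powr p / (2 powr p - 1)"
  have C: "C > 0" using p by (simp add: C_def)
  have "AE \<omega> in M. ennreal (1 / C) * (\<Sum>k. ennreal ((2 ^ k) powr p) * indicator (?T k) \<omega>) \<le> ennreal_powr (last_exit \<xi> \<eta> x \<omega>) p"
    using div unfolding positively_divergent_def
  proof eventually_elim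
    case (elim \<omega>)
    let ?A = "{n. 1 \<le> n \<and> perturbed_walk \<xi> \<eta> n \<omega> \<le> x}"
    have fin: "finite {n. perturbed_walk \<xi> \<eta> n \<omega> \<le> x}" by (rule finite_le_if_at_top[OF elim])
    have finA: "finite ?A" by (rule finite_subset[OF _ fin]) auto
    define n where "n = Max (insert 0 ?A)"
    have "indicator (?T k) \<omega> \<le> (indicator {k. 2 ^ k \<le> real n} k :: ennreal)" for k
    proof (cases "\<omega> \<in> ?T k")
      case True
      then obtain i where i: "2 ^ k \<le> i" "perturbed_walk \<xi> \<eta> i \<omega> \<le> x" by auto
      moreover have "1 \<le> (2::nat) ^ k" by simp
      ultimately have "i \<in> insert 0 ?A" using order_trans by blast
      then have "i \<le> n" unfolding n_def using finA by (intro Max_ge) auto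
      then have "2 ^ k \<le> n" using i by simp
      then have "2 ^ k \<le> real n" by (metis of_nat_le_iff of_nat_numeral of_nat_power)
      then show ?thesis by (simp add: indicator_def)
    qed simp
    then have "(\<Sum>k. ennreal ((2 ^ k) powr p) * indicator (?T k) \<omega>)
        \<le> (\<Sum>k. ennreal ((2 ^ k) powr p) * indicator {k. 2 ^ k \<le> real n} k)"
      by (intro suminf_le mult_left_mono) auto
    also have "\<dots> \<le> ennreal (C * real n powr p)"
      unfolding C_def by (rule dyadic_sum_le_powr[OF p]) simp
    finally have "ennreal (1 / C) * (\<Sum>k. ennreal ((2 ^ k) powr p) * indicator (?T k) \<omega>)
        \<le> ennreal (1 / C) * ennreal (C * real n powr p)" by (rule mult_left_mono) simp
    also have "\<dots> = ennreal (real n powr p)"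
      using C by (simp add: ennreal_mult'[symmetric])
    finally show ?case
      by (simp add: last_exit_eq_Max[OF fin] n_def ennreal_powr_of_nat)
  qed
  then have "(\<integral>\<^sup>+\<omega>. ennreal (1 / C) * (\<Sum>k. ennreal ((2 ^ k) powr p) * indicator (?T k) \<omega>) \<partial>M)
      \<le> (\<integral>\<^sup>+\<omega>. ennreal_powr (last_exit \<xi> \<eta> x \<omega>) p \<partial>M)"
    by (rule nn_integral_mono_AE)
  also have "(\<integral>\<^sup>+\<omega>. ennreal (1 / C) * (\<Sum>k. ennreal ((2 ^ k) powr p) * indicator (?T k) \<omega>) \<partial>M)
      = ennreal (1 / C) * dyadic_tail_sum (perturbed_walk \<xi> \<eta>) p x"
    unfolding dyadic_tail_sum_def
    by (simp add: nn_integral_cmult nn_integral_suminf)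
  finally have "ennreal (1 / C) * dyadic_tail_sum (perturbed_walk \<xi> \<eta>) p x < \<infinity>" using fin by simp
  then show ?thesis using C by (auto simp: ennreal_mult_less_top)
qed

text \<open>A positive last exit time lies in some dyadic block and the walk is low there. Events of
  single blocks, unlike tail events, involve finitely many pairs, as the maximal inequality
  requires.\<close>

lemma last_exit_moment_le:
  assumes div: "positively_divergent M \<xi> \<eta>" and p: "p > 0"
  shows "(\<integral>\<^sup>+\<omega>. ennreal_powr (last_exit \<xi> \<eta> x \<omega>) p \<partial>M)
    \<le> (\<Sum>j. ennreal ((2 ^ Suc j) powr p)
        * emeasure M {\<omega> \<in> space M. \<exists>n\<in>{2 ^ j..<2 ^ Suc j}. perturbed_walk \<xi> \<eta> n \<omega> \<le> x})"
proof -
  let ?B = "\<lambda>j. {\<omega> \<in> space M. \<exists>n\<in>{2 ^ j..<2 ^ Suc j}. perturbed_walk \<xi> \<eta> n \<omega> \<le> x}"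
  have "AE \<omega> in M. ennreal_powr (last_exit \<xi> \<eta> x \<omega>) p \<le> (\<Sum>j. ennreal ((2 ^ Suc j) powr p) * indicator (?B j) \<omega>)"
    using div[unfolded positively_divergent_def] AE_space
  proof eventually_elim
    case (elim \<omega>)
    let ?A = "{n. 1 \<le> n \<and> perturbed_walk \<xi> \<eta> n \<omega> \<le> x}"
    have fin: "finite {n. perturbed_walk \<xi> \<eta> n \<omega> \<le> x}" by (rule finite_le_if_at_top[OF elim(1)])
    have finA: "finite ?A" by (rule finite_subset[OF _ fin]) auto
    define n where "n = Max (insert 0 ?A)"
    have "n \<in> insert 0 ?A" unfolding n_def using finA by (intro Max_in) auto
    have "ennreal (real n powr p) \<le> (\<Sum>j. ennreal ((2 ^ Suc j) powr p) * indicator (?B j) \<omega>)"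
    proof (cases "n = 0")
      case False
      then have n: "1 \<le> n" "perturbed_walk \<xi> \<eta> n \<omega> \<le> x" using \<open>n \<in> insert 0 ?A\<close> by auto
      then obtain j where j: "2 ^ j \<le> real n" "real n < 2 ^ Suc j" using dyadic_bracket[of "real n"] by auto
      have j': "2 ^ j \<le> n" "n < 2 ^ Suc j"
        using j by (metis of_nat_le_iff of_nat_numeral of_nat_power, metis of_nat_less_iff of_nat_numeral of_nat_power)
      then have "\<omega> \<in> ?B j" using n elim(2) by auto
      have "ennreal (real n powr p) \<le> ennreal ((2 ^ Suc j) powr p)"
        using j p by (intro ennreal_leI powr_mono2) auto
      also have "\<dots> = (\<Sum>i\<in>{j}. ennreal ((2 ^ Suc i) powr p) * indicator (?B i) \<omega>)"
        using \<open>\<omega> \<in> ?B j\<close> by (simp only: sum.insert finite.emptyI empty_iff sum.empty add_0_right not_False_eq_True indicator_simps mult_1_right)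
      also have "\<dots> \<le> (\<Sum>i. ennreal ((2 ^ Suc i) powr p) * indicator (?B i) \<omega>)"
        by (intro sum_le_suminf) auto
      finally show ?thesis .
    qed simp
    then show ?case by (simp add: last_exit_eq_Max[OF fin] n_def ennreal_powr_of_nat)
  qed
  then have "(\<integral>\<^sup>+\<omega>. ennreal_powr (last_exit \<xi> \<eta> x \<omega>) p \<partial>M)
    \<le> (\<integral>\<^sup>+\<omega>. (\<Sum>j. ennreal ((2 ^ Suc j) powr p) * indicator (?B j) \<omega>) \<partial>M)"
    by (rule nn_integral_mono_AE)
  also have "\<dots> = (\<Sum>j. ennreal ((2 ^ Suc j) powr p) * emeasure M (?B j))"
    by (subst nn_integral_suminf) (auto simp: nn_integral_cmult)
  finally show ?thesis .
qed

lemma truncated_mean_xi: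
  assumes "AE \<omega> in M. filterlim (\<lambda>n. walk \<xi> n \<omega>) at_top sequentially"
  shows "truncated_mean M (\<xi> 0)"
  by unfold_locales (use prob_xi_pos[OF assms] in auto)

text \<open>
  If \<open>J a \<ge> 4 n\<close>, then by Markov's inequality the walk is still below \<open>a\<close> with probability at least
  1/2 at each of the times \<open>n, \<dots>, 2 n - 1\<close>, so each of the \<open>n\<close> next perturbations has a chance
  to bring the perturbed walk below \<open>x\<close>.
\<close>
lemma prob_perturbed_walk_tail_ge:
  assumes tm: "truncated_mean M (\<xi> 0)" and n: "1 \<le> n" and a: "0 < a" and J: "4 * real n \<le> J_plus M (\<xi> 0) a"
  shows "min (1 / 4) (n * prob {\<omega> \<in> space M. \<eta> 0 \<omega> \<le> x - a} / 4)
    \<le> prob {\<omega> \<in> space M. \<exists>m\<ge>n. perturbed_walk \<xi> \<eta> m \<omega> \<le> x}"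
proof -
  interpret tm: truncated_mean M "\<xi> 0" by (rule tm)
  define F where "F = (\<lambda>k. {\<omega> \<in> space M. walk \<xi> k \<omega> \<le> a})"
  define B where "B = {z :: real \<times> real. snd z \<le> x - a}"
  have B: "B \<in> sets borel"
  proof -
    have "{z \<in> space borel. snd z \<le> x - a} \<in> sets (borel :: (real \<times> real) measure)" by measurable
    then show ?thesis by (simp add: B_def)
  qed
  have F: "F k \<in> sets (past k)" for k
  proof -
    have "{\<omega> \<in> space (past k). walk \<xi> k \<omega> \<le> a} \<in> sets (past k)"
      using measurable_walk_past[OF order_refl] by measurable
    then show ?thesis by (simp add: F_def)
  qed
  have half: "1 / 2 \<le> prob (F k)" if "k \<in> {n..<2*n}" for k
  proof -
    define W where "W = (\<lambda>\<omega>. \<Sum>i=1..k. min (max (\<xi> i \<omega>) 0) a)"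
    have iW: "integrable M W" unfolding W_def using a by (intro Bochner_Integration.integrable_sum integrable_min_pos) auto
    \<comment> \<open>Above \<open>a\<close> either one step alone reaches \<open>a\<close>, and its
      truncation does so too, or truncation changes no positive step and \<open>W\<close> dominates
      the walk.\<close>
    have "{\<omega> \<in> space M. \<not> walk \<xi> k \<omega> \<le> a} \<subseteq> {\<omega> \<in> space M. a \<le> W \<omega>}"
    proof safe
      fix \<omega> assume *: "\<not> walk \<xi> k \<omega> \<le> a"
      show "a \<le> W \<omega>"
      proof (cases "\<exists>i\<in>{1..k}. a \<le> \<xi> i \<omega>")
        case True
        then obtain i where i: "i \<in> {1..k}" "a \<le> \<xi> i \<omega>" by auto
        have "min (max (\<xi> i \<omega>) 0) a \<le> W \<omega>" unfolding W_def using i a by (intro member_le_sum) auto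
        then show ?thesis using i by simp
      next
        case False
        then have "walk \<xi> k \<omega> \<le> W \<omega>" unfolding W_def walk_def by (intro sum_mono) force
        then show ?thesis using * by simp
      qed
    qed
    then have "prob {\<omega> \<in> space M. \<not> walk \<xi> k \<omega> \<le> a} \<le> prob {\<omega> \<in> space M. a \<le> W \<omega>}"
      by (intro finite_measure_mono) (use iW in auto)
    also have "\<dots> \<le> expectation W / a"
    proof (rule integral_Markov_inequality_measure[OF iW])
      show "space M \<in> events" by simp
      show "AE \<omega> in M. 0 \<le> W \<omega>" using a unfolding W_def by (intro AE_I2 sum_nonneg) auto
    qed (rule a)
    also have "expectation W = (\<Sum>i=1..k. expectation (\<lambda>\<omega>. min (max (\<xi> i \<omega>) 0) a))"
      unfolding W_def by (intro Bochner_Integration.integral_sum integrable_min_pos) (use a in auto)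
    also have "\<dots> = k * A_plus M (\<xi> 0) a"
    proof -
      have "expectation (\<lambda>\<omega>. min (max (\<xi> i \<omega>) 0) a) = A_plus M (\<xi> 0) a" for i
        using expectation_X_eq[of "\<lambda>z. min (max (fst z) 0) a" i] a by (simp add: tm.A_eq)
      then show ?thesis by simp
    qed
    \<comment> \<open>Since \<open>k < 2 * n\<close>, the bound is \<open>2 * n / J a\<close>; the
      factor 4 in the hypothesis turns this into 1/2.\<close>
    also have "k * A_plus M (\<xi> 0) a / a \<le> 2 * n * A_plus M (\<xi> 0) a / a"
      using that tm.A_pos[OF a] a by (intro divide_right_mono mult_right_mono) auto
    also have "\<dots> \<le> 1 / 2" using J tm.A_pos[OF a] a by (simp add: tm.J_eq field_simps)
    finally have "prob {\<omega> \<in> space M. \<not> walk \<xi> k \<omega> \<le> a} \<le> 1 / 2" .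
    moreover have "prob {\<omega> \<in> space M. \<not> walk \<xi> k \<omega> \<le> a} = 1 - prob (F k)"
      unfolding F_def by (rule prob_neg) measurable
    ultimately show ?thesis by simp
  qed
  have "prob (\<Union>k\<in>{n..<2 * n}. F k \<inter> {\<omega> \<in> space M. X (Suc k) \<omega> \<in> B})
      \<le> prob {\<omega> \<in> space M. \<exists>m\<ge>n. perturbed_walk \<xi> \<eta> m \<omega> \<le> x}"
  proof (intro finite_measure_mono subsetI)
    fix \<omega> assume "\<omega> \<in> (\<Union>k\<in>{n..<2 * n}. F k \<inter> {\<omega> \<in> space M. X (Suc k) \<omega> \<in> B})"
    then obtain k where "\<omega> \<in> space M" "n \<le> k" "walk \<xi> k \<omega> \<le> a" "\<eta> (Suc k) \<omega> \<le> x - a"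
      by (auto simp: F_def B_def)
    then show "\<omega> \<in> {\<omega> \<in> space M. \<exists>m\<ge>n. perturbed_walk \<xi> \<eta> m \<omega> \<le> x}"
      by (auto simp: perturbed_walk_def intro!: exI[of _ "Suc k"])
  qed measurable
  with prob_some_success[of F n B, OF F half B] show ?thesis by (simp add: B_def)
qed

text \<open>By monotonicity the level \<open>16 * 2 ^ k\<close> of \<open>J\<close> is exceeded on a
  half-line with left end \<open>z0\<close>. Below \<open>z0 / 2\<close> the walk lingers long
  enough, while a perturbation at which \<open>J\<close> reaches that level is at most
  \<open>- z0\<close>. The factor \<open>2 ^ k\<close> won in \<open>key\<close> is the step from
  order \<open>p\<close> to \<open>p + 1\<close>.\<close>

lemma J_moment_finite:
  assumes div: "positively_divergent M \<xi> \<eta>" and p: "p > 0"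
    and fin: "dyadic_tail_sum (perturbed_walk \<xi> \<eta>) p x < \<infinity>"
  shows "(\<integral>\<^sup>+\<omega>. ennreal (J_plus M (\<xi> 0) (max (- \<eta> 0 \<omega>) 0) powr (p + 1)) \<partial>M) < \<infinity>"
proof -
  have tm: "truncated_mean M (\<xi> 0)" by (rule truncated_mean_xi[OF walk_diverges[OF div]])
  interpret tm: truncated_mean M "\<xi> 0" by (rule tm)
  let ?J = "\<lambda>\<omega>. tm.J (max (- \<eta> 0 \<omega>) 0)"
  let ?T = "\<lambda>n::nat. {\<omega> \<in> space M. \<exists>m\<ge>n. perturbed_walk \<xi> \<eta> m \<omega> \<le> x}"
  have "(\<lambda>n. prob (?T n)) \<longlonglongrightarrow> 0"
    using div unfolding positively_divergent_def by (intro tail_prob_tendsto_0) auto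
  then have "\<forall>\<^sub>F n in sequentially. prob (?T n) < 1 / 4" by (intro order_tendstoD(2)) auto
  then obtain n0 where n0: "\<And>n. n \<ge> n0 \<Longrightarrow> prob (?T n) < 1 / 4" by (auto simp: eventually_sequentially)
  \<comment> \<open>Beyond \<open>k0\<close> the tail probability is below 1/4 and the level set of
    \<open>J\<close> lies to the right of \<open>2 * \<bar>x\<bar> + 1\<close>.\<close>
  obtain k0 :: nat where k0: "max (real n0) (tm.J (2 * \<bar>x\<bar> + 1)) < 2 ^ k0"
    using real_arch_pow[of 2 "max (real n0) (tm.J (2 * \<bar>x\<bar> + 1))"] by auto
  have key: "2 ^ k * prob {\<omega> \<in> space M. 16 * 2 ^ k \<le> ?J \<omega>} \<le> 4 * prob (?T (2 ^ k))" if k: "k0 \<le> k" for k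
  proof -
    define U where "U = {z. 0 \<le> z \<and> 16 * 2 ^ k \<le> tm.J z}"
    show ?thesis
    proof (cases "U = {}")
      case True
      then have "{\<omega> \<in> space M. 16 * 2 ^ k \<le> ?J \<omega>} = {}" by (auto simp: U_def)
      then show ?thesis by (simp only: measure_empty) simp
    next
      case False
      define z0 where "z0 = Inf U"
      have kk: "(2::real) ^ k0 \<le> 2 ^ k" using k by (intro power_increasing) auto
      have k1: "tm.J (2 * \<bar>x\<bar> + 1) < 2 ^ k" and k2: "real n0 < 2 ^ k" using k0 kk by linarith+
      have "2 * \<bar>x\<bar> + 1 \<le> z" if "z \<in> U" for z
      proof (rule ccontr)
        assume "\<not> ?thesis"
        then have "tm.J z \<le> tm.J (2 * \<bar>x\<bar> + 1)" using that by (intro tm.J_mono) (auto simp: U_def)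
        then show False using that k1 zero_less_power[of "2::real" k] unfolding U_def mem_Collect_eq by linarith
      qed
      then have z0: "2 * \<bar>x\<bar> + 1 \<le> z0" unfolding z0_def using False by (intro cInf_greatest) auto
      have bdd: "bdd_below U" by (rule bdd_belowI[of _ 0]) (simp add: U_def)
      have le: "z0 \<le> z" if "z \<in> U" for z unfolding z0_def by (rule cInf_lower[OF that bdd])
      \<comment> \<open>Halving makes room for \<open>x\<close>: a perturbation at most
        \<open>- 2 * a\<close> is at most \<open>x - a\<close>, as
        \<open>\<bar>x\<bar> \<le> a\<close>.\<close>
      define a where "a = z0 / 2"
      have a: "0 < a" "\<bar>x\<bar> \<le> a" using z0 by (auto simp: a_def)
      have "z0 < 2 * z0" using z0 by linarith
      then obtain z where z: "z \<in> U" "z < 2 * z0" unfolding z0_def[symmetric]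
        using cInf_lessD[OF False, of "2 * z0"] unfolding z0_def by auto
      \<comment> \<open>The infimum may lie outside \<open>U\<close>, so a point
        \<open>z < 4 * a\<close> of \<open>U\<close> is used. Two doublings reduce 16 to the factor
        4 that \<open>prob_perturbed_walk_tail_ge\<close> requires.\<close>
      have "16 * 2 ^ k \<le> tm.J z" using z by (simp add: U_def)
      also have "\<dots> \<le> tm.J (2 * (2 * a))" using z by (intro tm.J_mono) (auto simp: U_def a_def)
      also have "\<dots> \<le> 2 * tm.J (2 * a)" using a by (intro tm.J_double) auto
      also have "tm.J (2 * a) \<le> 2 * tm.J a" using a by (intro tm.J_double) auto
      finally have Ja: "4 * real (2 ^ k) \<le> tm.J a" by simp
      have "min (1 / 4) (real (2 ^ k) * prob {\<omega> \<in> space M. \<eta> 0 \<omega> \<le> x - a} / 4) \<le> prob (?T (2 ^ k))"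
        by (rule prob_perturbed_walk_tail_ge[OF tm _ a(1) Ja]) simp
      \<comment> \<open>Past \<open>n0\<close> the value 1/4 of the minimum is excluded.\<close>
      moreover have "real n0 \<le> real (2 ^ k)" using k2 by simp
      then have "prob (?T (2 ^ k)) < 1 / 4" by (intro n0) (simp only: of_nat_le_iff)
      ultimately have "2 ^ k * prob {\<omega> \<in> space M. \<eta> 0 \<omega> \<le> x - a} \<le> 4 * prob (?T (2 ^ k))"
        by (auto simp: min_def split: if_splits)
      moreover have "prob {\<omega> \<in> space M. 16 * 2 ^ k \<le> ?J \<omega>} \<le> prob {\<omega> \<in> space M. \<eta> 0 \<omega> \<le> x - a}"
      proof (intro finite_measure_mono subsetI)
        fix \<omega> assume \<omega>: "\<omega> \<in> {\<omega> \<in> space M. 16 * 2 ^ k \<le> ?J \<omega>}"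
        then have "max (- \<eta> 0 \<omega>) 0 \<in> U" by (auto simp: U_def)
        then have "2 * a \<le> max (- \<eta> 0 \<omega>) 0" using le by (simp add: a_def)
        then have "\<eta> 0 \<omega> \<le> x - a" using a by (auto simp: max_def split: if_splits)
        then show "\<omega> \<in> {\<omega> \<in> space M. \<eta> 0 \<omega> \<le> x - a}" using \<omega> by auto
      qed measurable
      ultimately show ?thesis by (meson mult_left_mono order_trans zero_le_numeral zero_le_power)
    qed
  qed
  define r where "r = p + 1"
  let ?g = "\<lambda>k \<omega>. ennreal ((2 * 16 * 2 ^ k) powr r) * indicator {k. k0 \<le> k \<and> 16 * 2 ^ k \<le> ?J \<omega>} k"
  have gm[measurable]: "(\<lambda>\<omega>. ?g k \<omega>) \<in> borel_measurable M" for k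
  proof -
    have "(\<lambda>\<omega>. ?g k \<omega>) = (\<lambda>\<omega>. if k0 \<le> k \<and> 16 * 2 ^ k \<le> ?J \<omega> then ennreal ((2 * 16 * 2 ^ k) powr r) else 0)"
      by (auto simp: indicator_def)
    then show ?thesis by simp
  qed
  have "(\<integral>\<^sup>+\<omega>. ennreal (?J \<omega> powr r) \<partial>M) \<le> (\<integral>\<^sup>+\<omega>. ennreal ((16 * 2 ^ k0) powr r) + (\<Sum>k. ?g k \<omega>) \<partial>M)"
    using p tm.J_ge_1 by (intro nn_integral_mono powr_le_dyadic_sum) (auto simp: r_def intro: order_trans[OF zero_le_one])
  also have "\<dots> = ennreal ((16 * 2 ^ k0) powr r) + (\<Sum>k. \<integral>\<^sup>+\<omega>. ?g k \<omega> \<partial>M)"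
    by (simp add: nn_integral_add nn_integral_suminf emeasure_space_1)
  also have "(\<Sum>k. \<integral>\<^sup>+\<omega>. ?g k \<omega> \<partial>M) \<le> (\<Sum>k. ennreal (4 * 32 powr r) * (ennreal ((2 ^ k) powr p) * emeasure M (?T (2 ^ k))))"
  proof (intro suminf_le summableI)
    fix k
    show "(\<integral>\<^sup>+\<omega>. ?g k \<omega> \<partial>M) \<le> ennreal (4 * 32 powr r) * (ennreal ((2 ^ k) powr p) * emeasure M (?T (2 ^ k)))"
    proof (cases "k0 \<le> k")
      case True
      have "(\<integral>\<^sup>+\<omega>. ?g k \<omega> \<partial>M) = (\<integral>\<^sup>+\<omega>. ennreal ((2 * 16 * 2 ^ k) powr r) * indicator {\<omega> \<in> space M. 16 * 2 ^ k \<le> ?J \<omega>} \<omega> \<partial>M)"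
        using True by (intro nn_integral_cong) (auto simp: indicator_def)
      also have "\<dots> = ennreal ((2 * 16 * 2 ^ k) powr r) * emeasure M {\<omega> \<in> space M. 16 * 2 ^ k \<le> ?J \<omega>}"
        by (subst nn_integral_cmult_indicator) auto
      also have "\<dots> = ennreal ((2 * 16 * 2 ^ k) powr r * prob {\<omega> \<in> space M. 16 * 2 ^ k \<le> ?J \<omega>})"
        by (simp add: emeasure_eq_measure ennreal_mult)
      \<comment> \<open>One factor \<open>2 ^ k\<close> is split off, to be spent on
        \<open>key\<close>.\<close>
      also have "(2 * 16 * 2 ^ k) powr r * prob {\<omega> \<in> space M. 16 * 2 ^ k \<le> ?J \<omega>}
          = 32 powr r * (2 ^ k) powr p * (2 ^ k * prob {\<omega> \<in> space M. 16 * 2 ^ k \<le> ?J \<omega>})"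
        by (simp add: powr_mult r_def powr_add)
      also have "ennreal \<dots> \<le> ennreal (32 powr r * (2 ^ k) powr p * (4 * prob (?T (2 ^ k))))"
        by (intro ennreal_leI mult_left_mono key[OF True]) auto
      also have "\<dots> = ennreal (4 * 32 powr r) * (ennreal ((2 ^ k) powr p) * emeasure M (?T (2 ^ k)))"
        by (simp add: emeasure_eq_measure ennreal_mult[symmetric] mult_ac)
      finally show ?thesis .
    qed simp
  qed
  also have "\<dots> = ennreal (4 * 32 powr r) * dyadic_tail_sum (perturbed_walk \<xi> \<eta>) p x"
    unfolding dyadic_tail_sum_def by (rule ennreal_suminf_cmult)
  also have "ennreal ((16 * 2 ^ k0) powr r) + \<dots> < \<infinity>"
    using fin by (simp add: ennreal_mult_less_top)
  finally show ?thesis unfolding r_def by (simp add: add_left_mono)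
qed

text \<open>\<open>prob_walk_tail_le\<close> applied to each term. The level drops to
  \<open>x - K\<close>, possibly below 0, which does no harm because \<open>J_moment_finite\<close>
  accepts any level.\<close>

lemma dyadic_tail_sum_walk_finite:
  assumes fin: "dyadic_tail_sum (perturbed_walk \<xi> \<eta>) p x < \<infinity>"
  shows "\<exists>y. dyadic_tail_sum (walk \<xi>) p y < \<infinity>"
proof -
  obtain K where K: "0 < prob {\<omega> \<in> space M. \<eta> 0 \<omega> \<le> K}" using ex_prob_le_pos[of "\<eta> 0"] by auto
  define q where "q = prob {\<omega> \<in> space M. \<eta> 0 \<omega> \<le> K}"
  have "ennreal q * dyadic_tail_sum (walk \<xi>) p (x - K) \<le> dyadic_tail_sum (perturbed_walk \<xi> \<eta>) p x"
    unfolding dyadic_tail_sum_def ennreal_suminf_cmult[symmetric]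
  proof (intro suminf_le summableI)
    fix k :: nat
    let ?S = "{\<omega> \<in> space M. \<exists>n\<ge>2 ^ k. walk \<xi> n \<omega> \<le> x - K}"
    let ?T = "{\<omega> \<in> space M. \<exists>n\<ge>2 ^ k. perturbed_walk \<xi> \<eta> n \<omega> \<le> x}"
    have "prob ?S * q \<le> prob ?T" using prob_walk_tail_le[of "2 ^ k" "x - K" K] by (simp add: q_def)
    then have "(2 ^ k) powr p * (prob ?S * q) \<le> (2 ^ k) powr p * prob ?T" by (intro mult_left_mono) auto
    then show "ennreal q * (ennreal ((2 ^ k) powr p) * emeasure M ?S) \<le> ennreal ((2 ^ k) powr p) * emeasure M ?T"
      by (simp add: emeasure_eq_measure ennreal_mult[symmetric] q_def ennreal_leI mult_ac)
  qed
  then have "ennreal q * dyadic_tail_sum (walk \<xi>) p (x - K) < \<infinity>" using fin by (rule le_less_trans)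
  then show ?thesis using K by (intro exI[of _ "x - K"]) (auto simp: ennreal_mult_less_top q_def)
qed

lemma dyadic_tail_sum_self: "dyadic_tail_sum (perturbed_walk \<xi> \<xi>) p y = dyadic_tail_sum (walk \<xi>) p y"
proof -
  have "(\<exists>n\<ge>2 ^ k. perturbed_walk \<xi> \<xi> n \<omega> \<le> y) \<longleftrightarrow> (\<exists>n\<ge>2 ^ k. walk \<xi> n \<omega> \<le> y)" for k \<omega>
  proof -
    have "perturbed_walk \<xi> \<xi> n \<omega> = walk \<xi> n \<omega>" if "2 ^ k \<le> n" for n
      using that one_le_power[of "2::nat" k] by (intro perturbed_walk_self) linarith
    then show ?thesis by metis
  qed
  then show ?thesis unfolding dyadic_tail_sum_def by simp
qed

lemma self_diverges:
  assumes "AE \<omega> in M. filterlim (\<lambda>n. walk \<xi> n \<omega>) at_top sequentially"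
  shows "positively_divergent M \<xi> \<xi>"
  unfolding positively_divergent_def
  using assms
proof eventually_elim
  case (elim \<omega>)
  have "\<forall>\<^sub>F n in sequentially. walk \<xi> n \<omega> = perturbed_walk \<xi> \<xi> n \<omega>"
    using eventually_ge_at_top[of 1] by eventually_elim (simp add: perturbed_walk_self)
  then show ?case using elim by (simp add: filterlim_cong)
qed

end

section \<open>Sufficiency of the moment conditions\<close>

text \<open>
  Adding indices from the smallest one, with an arbitrary starting value \<open>a\<close>, reduces Doob's maximal
  inequality for the supermartingale of partial products to a one-step estimate.
\<close>
lemma (in prob_space) product_maximal_inequality:
  fixes I :: "nat set" and g :: "'a \<Rightarrow> ennreal" and a b c :: ennreal
  assumes I: "finite I" and [measurable]: "g \<in> borel_measurable M"
    and g: "(\<integral>\<^sup>+y. g y \<partial>M) \<le> c" and c: "c \<le> 1"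
  shows "b * emeasure (\<Pi>\<^sub>M i\<in>I. M) {u \<in> space (\<Pi>\<^sub>M i\<in>I. M). \<exists>n\<ge>m. b \<le> a * (\<Prod>i\<in>{i\<in>I. i \<le> n}. g (u i))}
    \<le> a * c ^ card {i\<in>I. i \<le> m}"
  using I
proof (induction I arbitrary: a rule: finite_linorder_min_induct)
  case empty
  interpret P: prob_space "\<Pi>\<^sub>M i\<in>{}. M" by (intro prob_space_PiM prob_space_axioms)
  show ?case
  proof (cases "b \<le> a")
    case True
    have "b * emeasure (\<Pi>\<^sub>M i\<in>{}. M) S \<le> b * 1" for S
      by (intro mult_left_mono P.measure_le_1) auto
    then show ?thesis using True by (auto intro: order_trans)
  qed simp
next
  case (insert k I)
  interpret PP: product_sigma_finite "\<lambda>_. M" by standard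
  interpret P: prob_space "\<Pi>\<^sub>M i\<in>I. M" by (intro prob_space_PiM prob_space_axioms)
  interpret P': prob_space "\<Pi>\<^sub>M i\<in>insert k I. M" by (intro prob_space_PiM prob_space_axioms)
  define E where "E = (\<lambda>J a. {u \<in> space (\<Pi>\<^sub>M i\<in>J. M). \<exists>n\<ge>m. b \<le> a * (\<Prod>i\<in>{i\<in>J. i \<le> n}. g (u i))})"
  have Em[measurable]: "E J a \<in> sets (\<Pi>\<^sub>M i\<in>J. M)" for J a
  proof -
    have [measurable]: "(\<lambda>u. \<Prod>i\<in>{i\<in>J. i \<le> n}. g (u i)) \<in> borel_measurable (\<Pi>\<^sub>M i\<in>J. M)" for n
      by (intro borel_measurable_prod_ennreal measurable_compose[OF measurable_component_singleton]) auto
    show ?thesis unfolding E_def by measurable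
  qed
  have kI: "k \<notin> I" "finite I" using insert by auto
  have IH: "b * emeasure (\<Pi>\<^sub>M i\<in>I. M) (E I a) \<le> a * c ^ card {i\<in>I. i \<le> m}" for a
    using insert.IH unfolding E_def .
  show ?case
  proof (cases "b \<le> a \<and> m < k")
    \<comment> \<open>The new index \<open>k\<close> is the smallest, so no index is at most
      \<open>m\<close>; the exponent is 0 and \<open>b \<le> a\<close> suffices.\<close>
    case True
    then have e: "{i \<in> insert k I. i \<le> m} = {}" using insert.hyps by force
    have "b * emeasure (\<Pi>\<^sub>M i\<in>insert k I. M) S \<le> b * 1" for S
      by (intro mult_left_mono P'.measure_le_1) auto
    then have le: "b * emeasure (\<Pi>\<^sub>M i\<in>insert k I. M) S \<le> a" for S
      using True by (auto intro: order_trans)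
    show ?thesis unfolding e card.empty power_0 mult_1_right by (rule le)
  next
    case False
    have sub: "indicator (E (insert k I) a) (u(k := y)) \<le> (indicator (E I (a * g y)) u :: ennreal)"
      if u: "u \<in> space (\<Pi>\<^sub>M i\<in>I. M)" for u y
    proof (cases "u(k := y) \<in> E (insert k I) a")
      case uE: True
      then obtain n where n: "n \<ge> m" "b \<le> a * (\<Prod>i\<in>{i\<in>insert k I. i \<le> n}. g ((u(k := y)) i))"
        by (auto simp: E_def)
      \<comment> \<open>For \<open>n < k\<close> the product would be empty, giving
        \<open>b \<le> a\<close> with \<open>m \<le> n < k\<close>, the case just settled.\<close>
      have "k \<le> n"
      proof (rule ccontr)
        assume "\<not> k \<le> n"
        then have e: "{i\<in>insert k I. i \<le> n} = {}" using insert.hyps by force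
        from n(2) have "b \<le> a" unfolding e by simp
        then show False using n(1) False \<open>\<not> k \<le> n\<close> by simp
      qed
      then have "{i\<in>insert k I. i \<le> n} = insert k {i\<in>I. i \<le> n}" by auto
      then have "(\<Prod>i\<in>{i\<in>insert k I. i \<le> n}. g ((u(k := y)) i)) = g y * (\<Prod>i\<in>{i\<in>I. i \<le> n}. g ((u(k := y)) i))"
        using kI by simp
      also have "(\<Prod>i\<in>{i\<in>I. i \<le> n}. g ((u(k := y)) i)) = (\<Prod>i\<in>{i\<in>I. i \<le> n}. g (u i))"
        using kI by (intro prod.cong) auto
      finally have "b \<le> (a * g y) * (\<Prod>i\<in>{i\<in>I. i \<le> n}. g (u i))" using n(2) by (simp add: mult.assoc)
      then have "u \<in> E I (a * g y)" using n(1) u unfolding E_def by auto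
      then show ?thesis by (simp add: indicator_def)
    qed simp
    have "b * emeasure (\<Pi>\<^sub>M i\<in>insert k I. M) (E (insert k I) a)
        = (\<integral>\<^sup>+u. b * indicator (E (insert k I) a) u \<partial>(\<Pi>\<^sub>M i\<in>insert k I. M))"
      by (simp add: nn_integral_cmult_indicator)
    also have "\<dots> = (\<integral>\<^sup>+y. (\<integral>\<^sup>+u. b * indicator (E (insert k I) a) (u(k := y)) \<partial>(\<Pi>\<^sub>M i\<in>I. M)) \<partial>M)"
      by (rule PP.product_nn_integral_insert_rev[OF kI(2,1)]) measurable
    also have "\<dots> \<le> (\<integral>\<^sup>+y. b * emeasure (\<Pi>\<^sub>M i\<in>I. M) (E I (a * g y)) \<partial>M)"
    proof (intro nn_integral_mono)
      fix y
      have "(\<integral>\<^sup>+u. b * indicator (E (insert k I) a) (u(k := y)) \<partial>(\<Pi>\<^sub>M i\<in>I. M))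
          \<le> (\<integral>\<^sup>+u. b * indicator (E I (a * g y)) u \<partial>(\<Pi>\<^sub>M i\<in>I. M))"
        by (intro nn_integral_mono mult_left_mono sub) auto
      then show "(\<integral>\<^sup>+u. b * indicator (E (insert k I) a) (u(k := y)) \<partial>(\<Pi>\<^sub>M i\<in>I. M))
          \<le> b * emeasure (\<Pi>\<^sub>M i\<in>I. M) (E I (a * g y))" by (simp add: nn_integral_cmult_indicator)
    qed
    also have "\<dots> \<le> (\<integral>\<^sup>+y. a * c ^ card {i\<in>I. i \<le> m} * g y \<partial>M)"
    proof (intro nn_integral_mono)
      fix y show "b * emeasure (\<Pi>\<^sub>M i\<in>I. M) (E I (a * g y)) \<le> a * c ^ card {i\<in>I. i \<le> m} * g y"
        using IH[of "a * g y"] by (simp only: mult_ac)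
    qed
    also have "\<dots> = a * c ^ card {i\<in>I. i \<le> m} * (\<integral>\<^sup>+y. g y \<partial>M)" by (rule nn_integral_cmult) measurable
    also have "\<dots> \<le> a * c ^ card {i\<in>I. i \<le> m} * c" by (intro mult_left_mono g) simp
    \<comment> \<open>For \<open>k > m\<close> both counts are 0 and the surplus factor
      \<open>c \<le> 1\<close> is dropped.\<close>
    also have "\<dots> \<le> a * c ^ card {i\<in>insert k I. i \<le> m}"
    proof (cases "k \<le> m")
      case True
      then have "{i\<in>insert k I. i \<le> m} = insert k {i\<in>I. i \<le> m}" by auto
      then show ?thesis using kI by (simp add: mult_ac)
    next
      case nkm: False
      then have e: "{i\<in>insert k I. i \<le> m} = {}" "{i\<in>I. i \<le> m} = {}" using insert.hyps by force+
      show ?thesis unfolding e using mult_left_mono[OF c, of a] by simp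
    qed
    finally show ?thesis unfolding E_def .
  qed
qed

section \<open>Block estimate at the scale of the largest downward jump\<close>

context perturbed_random_walk
begin

lemma distr_restrict_X:
  assumes "I \<noteq> {}"
  shows "distr M (\<Pi>\<^sub>M i\<in>I. borel) (\<lambda>\<omega>. \<lambda>i\<in>I. X i \<omega>) = (\<Pi>\<^sub>M i\<in>I. distr M borel (X 0))"
proof -
  have "indep_vars (\<lambda>_. borel) X I" by (rule indep_vars_subset[OF indep]) simp
  then have "distr M (\<Pi>\<^sub>M i\<in>I. borel) (\<lambda>\<omega>. \<lambda>i\<in>I. X i \<omega>) = (\<Pi>\<^sub>M i\<in>I. distr M borel (X i))"
    using assms by (subst (asm) indep_vars_iff_distr_eq_PiM) auto
  also have "(\<lambda>i. distr M borel (X i)) = (\<lambda>_. distr M borel (X 0))" by (rule ext) (rule distr_X)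
  finally show ?thesis .
qed

text \<open>The floor \<open>b0\<close> keeps the scale in the range where the drift estimate holds
  and positive when nothing points downwards.\<close>

definition jump :: "real \<Rightarrow> real \<times> real \<Rightarrow> real" where
  "jump b0 z = max b0 (max (max (- fst z) 0) (max (- snd z) 0))"

lemma measurable_jump [measurable]: "jump b0 \<in> borel_measurable borel"
  unfolding jump_def by measurable

text \<open>
  Among all steps and perturbations up to time \<open>2 N\<close> let the largest downward jump have index
  \<open>k\<close> and size \<open>b\<close>. All other jumps are at least \<open>- b\<close>, so truncating them to \<open>[- b, b]\<close> only lowers
  the walk, and it does so independently of the pair with index \<open>k\<close>. The maximal inequality then
  applies to the exponential of the truncated walk at scale \<open>b\<close>. A deterministic scale would cost
  logarithmic factors.
\<close>
lemma prob_block_le: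
  assumes tm: "truncated_mean M (\<xi> 0)" and \<theta>: "0 < \<theta>" and b0: "0 < b0" and c0: "0 < c0"
    and laplace: "\<And>b. b0 \<le> b \<Longrightarrow> expectation (\<lambda>\<omega>. exp (- (\<theta> * clamp_real b (\<xi> 0 \<omega>) / b)))
      \<le> exp (- (c0 / J_plus M (\<xi> 0) b))"
    and N: "1 \<le> N"
  shows "emeasure M {\<omega> \<in> space M. \<exists>n\<in>{N..<2 * N}. perturbed_walk \<xi> \<eta> n \<omega> \<le> x}
    \<le> ennreal (2 * N * exp (2 * c0 + \<theta> * (2 + \<bar>x\<bar> / b0)))
      * (\<integral>\<^sup>+\<omega>. ennreal (exp (- (c0 * N / J_plus M (\<xi> 0) (jump b0 (X 0 \<omega>))))) \<partial>M)"
proof -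
  interpret tm: truncated_mean M "\<xi> 0" by (rule tm)
  define \<mu> where "\<mu> = distr M borel (X 0)"
  have sets_mu[measurable_cong, simp]: "sets \<mu> = sets borel" and space_mu[simp]: "space \<mu> = UNIV" by (auto simp: \<mu>_def)
  interpret mu: prob_space \<mu> unfolding \<mu>_def by (rule prob_space_distr) measurable
  interpret PP: product_sigma_finite "\<lambda>_. \<mu>" by standard
  \<comment> \<open>\<open>2 * c0\<close> pays for the at most two factors by which the product
    falls short of \<open>N\<close>; \<open>\<theta> * (2 + \<bar>x\<bar> / b0)\<close> bounds the
    exponent of \<open>1 / l\<close> below, uniformly in \<open>b \<ge> b0\<close>.\<close>
  define C where "C = exp (2 * c0 + \<theta> * (2 + \<bar>x\<bar> / b0))"
  define I where "I = {1..<2 * N}"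
  have I: "finite I" "I \<noteq> {}" "card I \<le> 2 * N" using N by (auto simp: I_def)
  define hit where "hit = (\<lambda>u :: nat \<Rightarrow> real \<times> real. \<exists>n\<in>{N..<2 * N}. (\<Sum>i=1..n-1. fst (u i)) + snd (u n) \<le> x)"
  define E where "E = {u \<in> space (\<Pi>\<^sub>M i\<in>I. \<mu>). hit u}"
  define Ek where "Ek = (\<lambda>k. {u \<in> space (\<Pi>\<^sub>M i\<in>I. \<mu>). hit u \<and> (\<forall>i\<in>I. jump b0 (u i) \<le> jump b0 (u k))})"
  have comp: "(\<lambda>u. u i) \<in> measurable (\<Pi>\<^sub>M i\<in>I. \<mu>) borel" if "i \<in> I" for i
    using measurable_component_singleton[OF that, of "\<lambda>_. \<mu>"]
    unfolding measurable_cong_sets[OF refl sets_mu] .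
  have [measurable]: "Measurable.pred (\<Pi>\<^sub>M i\<in>I. \<mu>) hit"
  proof -
    have "Measurable.pred (\<Pi>\<^sub>M i\<in>I. \<mu>) (\<lambda>u. (\<Sum>i=1..n-1. fst (u i)) + snd (u n) \<le> x)" if "n \<in> {N..<2 * N}" for n
    proof -
      have "(\<lambda>u. fst (u i)) \<in> borel_measurable (\<Pi>\<^sub>M i\<in>I. \<mu>)" if "i \<in> {1..n-1}" for i
        using that \<open>n \<in> {N..<2 * N}\<close> by (intro measurable_compose[OF comp measurable_fst_borel]) (auto simp: I_def)
      moreover have "(\<lambda>u. snd (u n)) \<in> borel_measurable (\<Pi>\<^sub>M i\<in>I. \<mu>)"
        using that N by (intro measurable_compose[OF comp measurable_snd_borel]) (auto simp: I_def)
      ultimately have [measurable]: "(\<lambda>u. (\<Sum>i=1..n-1. fst (u i)) + snd (u n)) \<in> borel_measurable (\<Pi>\<^sub>M i\<in>I. \<mu>)"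
        by (intro borel_measurable_add borel_measurable_sum)
      show ?thesis by measurable
    qed
    then show ?thesis unfolding hit_def by (intro pred_intros_finite) auto
  qed
  have [measurable]: "E \<in> sets (\<Pi>\<^sub>M i\<in>I. \<mu>)" unfolding E_def by measurable
  have Ekm[measurable]: "Ek k \<in> sets (\<Pi>\<^sub>M i\<in>I. \<mu>)" if "k \<in> I" for k
  proof -
    have j: "(\<lambda>u. jump b0 (u i)) \<in> borel_measurable (\<Pi>\<^sub>M i\<in>I. \<mu>)" if "i \<in> I" for i
      by (rule measurable_compose[OF comp[OF that] measurable_jump])
    have "Measurable.pred (\<Pi>\<^sub>M i\<in>I. \<mu>) (\<lambda>u. \<forall>i\<in>I. jump b0 (u i) \<le> jump b0 (u k))"
    proof (intro pred_intros_finite I)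
      fix i assume "i \<in> I"
      then show "Measurable.pred (\<Pi>\<^sub>M i\<in>I. \<mu>) (\<lambda>u. jump b0 (u i) \<le> jump b0 (u k))"
        unfolding pred_def by (intro borel_measurable_le j \<open>k \<in> I\<close>)
    qed
    then show ?thesis unfolding Ek_def by measurable
  qed
  have Ek_le: "emeasure (\<Pi>\<^sub>M i\<in>I. \<mu>) (Ek k)
      \<le> (\<integral>\<^sup>+z. ennreal (C * exp (- (c0 * N / tm.J (jump b0 z)))) \<partial>\<mu>)" if k: "k \<in> I" for k
  proof -
    define I' where "I' = I - {k}"
    have I': "finite I'" "k \<notin> I'" "insert k I' = I" using I k by (auto simp: I'_def)
    have "emeasure (\<Pi>\<^sub>M i\<in>I. \<mu>) (Ek k) = (\<integral>\<^sup>+u. indicator (Ek k) u \<partial>(\<Pi>\<^sub>M i\<in>insert k I'. \<mu>))"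
      using Ekm[OF k] I' by simp
    \<comment> \<open>The pair with index \<open>k\<close> is integrated last: for fixed
      \<open>z\<close> the scale \<open>b\<close> is a constant and the other pairs keep their
      product law.\<close>
    also have "\<dots> = (\<integral>\<^sup>+z. (\<integral>\<^sup>+u. indicator (Ek k) (u(k := z)) \<partial>(\<Pi>\<^sub>M i\<in>I'. \<mu>)) \<partial>\<mu>)"
      by (rule PP.product_nn_integral_insert_rev) (use I' Ekm[OF k] in auto)
    also have "\<dots> \<le> (\<integral>\<^sup>+z. ennreal (C * exp (- (c0 * N / tm.J (jump b0 z)))) \<partial>\<mu>)"
    proof (rule nn_integral_mono)
      fix z
      define b where "b = jump b0 z"
      have b: "b0 \<le> b" "0 < b" using b0 by (auto simp: b_def jump_def)
      define g where "g = (\<lambda>y :: real \<times> real. ennreal (exp (- (\<theta> * clamp_real b (fst y) / b))))"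
      have gm[measurable]: "g \<in> borel_measurable \<mu>"
        unfolding g_def by measurable
      define c where "c = exp (- (c0 / tm.J b))"
      have Jb: "1 \<le> tm.J b" using b by (intro tm.J_ge_1) auto
      have c1: "c \<le> 1" "0 \<le> c" using c0 Jb by (auto simp: c_def)
      have gint: "(\<integral>\<^sup>+y. g y \<partial>\<mu>) \<le> ennreal c"
      proof -
        have "(\<integral>\<^sup>+y. g y \<partial>\<mu>) = (\<integral>\<^sup>+\<omega>. g (X 0 \<omega>) \<partial>M)"
          unfolding \<mu>_def by (rule nn_integral_distr) (use gm in auto)
        also have "\<dots> = ennreal (expectation (\<lambda>\<omega>. exp (- (\<theta> * clamp_real b (\<xi> 0 \<omega>) / b))))"
          unfolding g_def fst_conv
        proof (rule nn_integral_eq_integral)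
          show "integrable M (\<lambda>\<omega>. exp (- (\<theta> * clamp_real b (\<xi> 0 \<omega>) / b)))"
          proof (intro integrable_const_bound[where B="exp \<theta>"] AE_I2)
            fix \<omega>
            have "\<bar>clamp_real b (\<xi> 0 \<omega>)\<bar> \<le> b" using b by (intro abs_clamp_real_le) auto
            then have "\<theta> * - clamp_real b (\<xi> 0 \<omega>) \<le> \<theta> * b" using \<theta> by (intro mult_left_mono) auto
            then have "- (\<theta> * clamp_real b (\<xi> 0 \<omega>) / b) \<le> \<theta>" using b by (simp add: field_simps)
            then show "norm (exp (- (\<theta> * clamp_real b (\<xi> 0 \<omega>) / b))) \<le> exp \<theta>" by simp
          qed measurable
        qed auto
        also have "\<dots> \<le> ennreal c" unfolding c_def by (intro ennreal_leI laplace b)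
        finally show ?thesis .
      qed
      \<comment> \<open>In \<open>x + 2 * b\<close> one \<open>b\<close> compensates the omitted
        step \<open>k\<close>, the other the perturbation at time \<open>n\<close>.\<close>
      define l where "l = exp (- (\<theta> * (x + 2 * b) / b))"
      define D where "D = {u \<in> space (\<Pi>\<^sub>M i\<in>I'. \<mu>). \<exists>n\<ge>N - 1. ennreal l \<le> 1 * (\<Prod>i\<in>{i\<in>I'. i \<le> n}. g (u i))}"
      have Dm[measurable]: "D \<in> sets (\<Pi>\<^sub>M i\<in>I'. \<mu>)"
      proof -
        have [measurable]: "(\<lambda>u. \<Prod>i\<in>{i\<in>I'. i \<le> n}. g (u i)) \<in> borel_measurable (\<Pi>\<^sub>M i\<in>I'. \<mu>)" for n
          by (intro borel_measurable_prod_ennreal measurable_compose[OF measurable_component_singleton]) auto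
        show ?thesis unfolding D_def by measurable
      qed
      have sub: "indicator (Ek k) (u(k := z)) \<le> (indicator D u :: ennreal)" if u: "u \<in> space (\<Pi>\<^sub>M i\<in>I'. \<mu>)" for u
      proof (cases "u(k := z) \<in> Ek k")
        case True
        define v where "v = u(k := z)"
        from True obtain n where n: "n \<in> {N..<2 * N}" "(\<Sum>i=1..n-1. fst (v i)) + snd (v n) \<le> x"
          unfolding Ek_def hit_def v_def by auto
        from True have "jump b0 (v i) \<le> jump b0 (v k)" if "i \<in> I" for i
          using that by (auto simp: Ek_def v_def)
        then have jb: "jump b0 (v i) \<le> b" if "i \<in> I" for i using that by (auto simp: v_def b_def)
        \<comment> \<open>This includes \<open>i = k\<close>, so the final perturbation is covered
          also when \<open>n = k\<close>.\<close>
        have fb: "- b \<le> fst (v i)" and sb: "- b \<le> snd (v i)" if "i \<in> I" for i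
          using jb[OF that] by (auto simp: jump_def)
        let ?S = "{i\<in>I'. i \<le> n - 1}"
        have nI: "n \<in> I" using n N by (auto simp: I_def)
        have "(\<Sum>i\<in>?S. clamp_real b (fst (u i))) \<le> (\<Sum>i\<in>?S. fst (v i))"
        proof (rule sum_mono)
          fix i assume i: "i \<in> ?S"
          then have "i \<in> I" "i \<noteq> k" by (auto simp: I'_def)
          then show "clamp_real b (fst (u i)) \<le> fst (v i)"
            using clamp_real_le[OF fb[of i]] by (simp add: v_def)
        qed
        also have "\<dots> \<le> (\<Sum>i=1..n-1. fst (v i)) + b"
        proof (cases "k \<le> n - 1")
          case True
          have "{1..n-1} = insert k ?S" using True n k by (auto simp: I'_def I_def)
          then have "(\<Sum>i=1..n-1. fst (v i)) = fst (v k) + (\<Sum>i\<in>?S. fst (v i))"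
            using I' by simp
          then show ?thesis using fb[OF k] by simp
        next
          case False
          then have "{1..n-1} = ?S" using n by (auto simp: I'_def I_def)
          then show ?thesis using b by simp
        qed
        also have "\<dots> \<le> x + 2 * b" using n(2) sb[OF nI] by simp
        finally have s: "(\<Sum>i\<in>?S. clamp_real b (fst (u i))) \<le> x + 2 * b" .
        have "(\<Prod>i\<in>?S. g (u i)) = ennreal (\<Prod>i\<in>?S. exp (- (\<theta> * clamp_real b (fst (u i)) / b)))"
          unfolding g_def by (rule prod_ennreal) simp
        also have "(\<Prod>i\<in>?S. exp (- (\<theta> * clamp_real b (fst (u i)) / b)))
            = exp (- (\<theta> * (\<Sum>i\<in>?S. clamp_real b (fst (u i))) / b))"
          using I' by (simp add: exp_sum[symmetric] sum_negf sum_distrib_left sum_divide_distrib)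
        also have "ennreal \<dots> \<ge> ennreal l" unfolding l_def
          using s \<theta> b by (intro ennreal_leI) (simp add: divide_right_mono)
        finally have "ennreal l \<le> 1 * (\<Prod>i\<in>?S. g (u i))" by simp
        moreover have "N - 1 \<le> n - 1" using n by auto
        ultimately have "u \<in> D" using u unfolding D_def by blast
        then show ?thesis by (simp add: indicator_def)
      qed simp
      have "(\<integral>\<^sup>+u. indicator (Ek k) (u(k := z)) \<partial>(\<Pi>\<^sub>M i\<in>I'. \<mu>)) \<le> (\<integral>\<^sup>+u. indicator D u \<partial>(\<Pi>\<^sub>M i\<in>I'. \<mu>))"
        by (intro nn_integral_mono sub)
      also have "\<dots> = emeasure (\<Pi>\<^sub>M i\<in>I'. \<mu>) D" by simp
      also have "\<dots> = ennreal (1 / l) * (ennreal l * emeasure (\<Pi>\<^sub>M i\<in>I'. \<mu>) D)"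
        by (simp add: mult.assoc[symmetric] ennreal_mult[symmetric] l_def)
      also have "ennreal l * emeasure (\<Pi>\<^sub>M i\<in>I'. \<mu>) D \<le> 1 * ennreal c ^ card {i\<in>I'. i \<le> N - 1}"
        unfolding D_def by (rule mu.product_maximal_inequality[OF I'(1) gm gint]) (use c1 in simp)
      also have "ennreal (1 / l) * (1 * ennreal c ^ card {i\<in>I'. i \<le> N - 1}) = ennreal (1 / l * c ^ card {i\<in>I'. i \<le> N - 1})"
        using c1 by (simp add: ennreal_power ennreal_mult[symmetric] l_def)
      also have "1 / l * c ^ card {i\<in>I'. i \<le> N - 1} \<le> C * exp (- (c0 * N / tm.J b))"
      proof -
        \<comment> \<open>Of the steps guaranteed before time \<open>N\<close>, the one with index
          \<open>k\<close> may be missing; this leaves at least \<open>N - 2\<close>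
          factors.\<close>
        have "{1..N-1} - {k} \<subseteq> {i\<in>I'. i \<le> N - 1}" by (auto simp: I'_def I_def)
        then have "card ({1..N-1} - {k}) \<le> card {i\<in>I'. i \<le> N - 1}" using I' by (intro card_mono) auto
        moreover have "N - 1 - 1 \<le> card ({1..N-1} - {k})"
          using diff_card_le_card_Diff[of "{k}" "{1..N-1}"] by simp
        ultimately have card: "real N - 2 \<le> real (card {i\<in>I'. i \<le> N - 1})" by linarith
        have "c ^ card {i\<in>I'. i \<le> N - 1} = exp (real (card {i\<in>I'. i \<le> N - 1}) * - (c0 / tm.J b))"
          unfolding c_def by (rule exp_of_nat_mult[symmetric])
        also have "\<dots> \<le> exp (2 * c0 - c0 * N / tm.J b)"
        proof -
          define d where "d = c0 / tm.J b"
          have "(real N - 2) * d \<le> real (card {i\<in>I'. i \<le> N - 1}) * d"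
            using card c0 Jb by (intro mult_right_mono) (auto simp: d_def)
          moreover have "d \<le> c0" using c0 Jb by (simp add: d_def field_simps)
          ultimately have "real (card {i\<in>I'. i \<le> N - 1}) * - d \<le> 2 * c0 - N * d"
            by (simp add: algebra_simps)
          then show ?thesis by (simp add: d_def mult.commute)
        qed
        finally have 1: "c ^ card {i\<in>I'. i \<le> N - 1} \<le> exp (2 * c0 - c0 * N / tm.J b)" .
        have "(x + 2 * b) / b \<le> 2 + \<bar>x\<bar> / b0"
        proof -
          have "x / b \<le> \<bar>x\<bar> / b" using b by (intro divide_right_mono) auto
          also have "\<dots> \<le> \<bar>x\<bar> / b0" using b b0 by (intro divide_left_mono) auto
          finally show ?thesis using b by (simp add: add_divide_distrib)
        qed
        then have "\<theta> * ((x + 2 * b) / b) \<le> \<theta> * (2 + \<bar>x\<bar> / b0)" using \<theta> by (intro mult_left_mono) auto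
        then have 2: "1 / l \<le> exp (\<theta> * (2 + \<bar>x\<bar> / b0))" by (simp add: l_def exp_minus field_simps)
        have "1 / l * c ^ card {i\<in>I'. i \<le> N - 1} \<le> exp (\<theta> * (2 + \<bar>x\<bar> / b0)) * exp (2 * c0 - c0 * N / tm.J b)"
          using 1 2 c1 by (intro mult_mono) auto
        also have "\<dots> = C * exp (- (c0 * N / tm.J b))" by (simp add: C_def exp_add[symmetric])
        finally show ?thesis .
      qed
      finally show "(\<integral>\<^sup>+u. indicator (Ek k) (u(k := z)) \<partial>(\<Pi>\<^sub>M i\<in>I'. \<mu>)) \<le> ennreal (C * exp (- (c0 * N / tm.J (jump b0 z))))"
        by (simp add: b_def ennreal_leI mult_left_mono)
    qed
    finally show ?thesis .
  qed
  have "emeasure M {\<omega> \<in> space M. \<exists>n\<in>{N..<2 * N}. perturbed_walk \<xi> \<eta> n \<omega> \<le> x}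
      = emeasure M ((\<lambda>\<omega>. \<lambda>i\<in>I. X i \<omega>) -` E \<inter> space M)"
  proof (rule arg_cong[where f="emeasure M"], rule set_eqI)
    fix \<omega>
    have "(\<Sum>i=1..n-1. fst ((\<lambda>i\<in>I. X i \<omega>) i)) + snd ((\<lambda>i\<in>I. X i \<omega>) n) = perturbed_walk \<xi> \<eta> n \<omega>"
      if "n \<in> {N..<2 * N}" for n
    proof -
      have "(\<Sum>i=1..n-1. fst ((\<lambda>i\<in>I. X i \<omega>) i)) = (\<Sum>i=1..n-1. \<xi> i \<omega>)"
        using that by (intro sum.cong) (auto simp: I_def)
      moreover have "n \<in> I" using that N by (auto simp: I_def)
      ultimately show ?thesis by (simp add: perturbed_walk_def walk_def)
    qed
    then have "hit (\<lambda>i\<in>I. X i \<omega>) \<longleftrightarrow> (\<exists>n\<in>{N..<2 * N}. perturbed_walk \<xi> \<eta> n \<omega> \<le> x)"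
      unfolding hit_def by simp
    then show "\<omega> \<in> {\<omega> \<in> space M. \<exists>n\<in>{N..<2 * N}. perturbed_walk \<xi> \<eta> n \<omega> \<le> x}
        \<longleftrightarrow> \<omega> \<in> (\<lambda>\<omega>. \<lambda>i\<in>I. X i \<omega>) -` E \<inter> space M"
      by (auto simp: E_def space_PiM)
  qed
  also have "\<dots> = emeasure (distr M (\<Pi>\<^sub>M i\<in>I. borel) (\<lambda>\<omega>. \<lambda>i\<in>I. X i \<omega>)) E"
  proof (rule emeasure_distr[symmetric])
    show "(\<lambda>\<omega>. \<lambda>i\<in>I. X i \<omega>) \<in> measurable M (\<Pi>\<^sub>M i\<in>I. borel)" by (intro measurable_restrict measurable_X)
    have "sets (\<Pi>\<^sub>M i\<in>I. \<mu>) = sets (\<Pi>\<^sub>M i\<in>I. borel)" by (intro sets_PiM_cong) auto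
    then show "E \<in> sets (\<Pi>\<^sub>M i\<in>I. borel)" using \<open>E \<in> sets (\<Pi>\<^sub>M i\<in>I. \<mu>)\<close> by metis
  qed
  also have "\<dots> = emeasure (\<Pi>\<^sub>M i\<in>I. \<mu>) E"
    unfolding distr_restrict_X[OF I(2)] \<mu>_def ..
  also have "\<dots> \<le> emeasure (\<Pi>\<^sub>M i\<in>I. \<mu>) (\<Union>k\<in>I. Ek k)"
  proof (rule emeasure_mono)
    show "E \<subseteq> (\<Union>k\<in>I. Ek k)"
    proof
      fix u assume u: "u \<in> E"
      obtain k where "k \<in> I" "\<And>i. i \<in> I \<Longrightarrow> jump b0 (u i) \<le> jump b0 (u k)"
      proof -
        have "Max ((\<lambda>i. jump b0 (u i)) ` I) \<in> (\<lambda>i. jump b0 (u i)) ` I" using I by (intro Max_in) auto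
        then obtain k where k: "k \<in> I" "Max ((\<lambda>i. jump b0 (u i)) ` I) = jump b0 (u k)" by auto
        show thesis using that[OF k(1)] k(2) I by (metis Max_ge finite_imageI imageI)
      qed
      then show "u \<in> (\<Union>k\<in>I. Ek k)" using u by (auto simp: E_def Ek_def)
    qed
    show "(\<Union>k\<in>I. Ek k) \<in> sets (\<Pi>\<^sub>M i\<in>I. \<mu>)" using Ekm I by auto
  qed
  also have "\<dots> \<le> (\<Sum>k\<in>I. emeasure (\<Pi>\<^sub>M i\<in>I. \<mu>) (Ek k))"
    using Ekm I by (intro emeasure_subadditive_finite) auto
  also have "\<dots> \<le> (\<Sum>k\<in>I. (\<integral>\<^sup>+z. ennreal (C * exp (- (c0 * N / tm.J (jump b0 z)))) \<partial>\<mu>))"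
    by (intro sum_mono Ek_le)
  also have "\<dots> \<le> ennreal (2 * N) * (\<integral>\<^sup>+z. ennreal (C * exp (- (c0 * N / tm.J (jump b0 z)))) \<partial>\<mu>)"
  proof -
    have "of_nat (card I) \<le> ennreal (2 * N)" using I(3) by (simp add: ennreal_of_nat_eq_real_of_nat ennreal_leI)
    then show ?thesis by (simp add: mult_right_mono)
  qed
  also have "(\<integral>\<^sup>+z. ennreal (C * exp (- (c0 * N / tm.J (jump b0 z)))) \<partial>\<mu>)
      = ennreal C * (\<integral>\<^sup>+\<omega>. ennreal (exp (- (c0 * N / tm.J (jump b0 (X 0 \<omega>))))) \<partial>M)"
  proof -
    have "jump b0 z = max (jump b0 z) 0" for z by (auto simp: jump_def max_def)
    then have [measurable]: "(\<lambda>z. tm.J (jump b0 z)) \<in> borel_measurable borel"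
      using tm.measurable_J_neg_part[OF measurable_jump[of b0]] by simp
    have "(\<integral>\<^sup>+z. ennreal (C * exp (- (c0 * N / tm.J (jump b0 z)))) \<partial>\<mu>)
        = (\<integral>\<^sup>+\<omega>. ennreal (C * exp (- (c0 * N / tm.J (jump b0 (X 0 \<omega>))))) \<partial>M)"
      unfolding \<mu>_def by (rule nn_integral_distr) measurable
    also have "\<dots> = (\<integral>\<^sup>+\<omega>. ennreal C * ennreal (exp (- (c0 * N / tm.J (jump b0 (X 0 \<omega>))))) \<partial>M)"
      by (intro nn_integral_cong ennreal_mult) (auto simp: C_def)
    also have "\<dots> = ennreal C * (\<integral>\<^sup>+\<omega>. ennreal (exp (- (c0 * N / tm.J (jump b0 (X 0 \<omega>))))) \<partial>M)"
      by (rule nn_integral_cmult) measurable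
    finally show ?thesis .
  qed
  finally show ?thesis by (simp add: C_def ennreal_mult mult.assoc)
qed

text \<open>The block estimates at \<open>N = 2 ^ j\<close> are summed inside the expectation, where
  \<open>dyadic_exp_sum_le\<close> yields \<open>Y powr (p + 1)\<close> for the random scale
  \<open>Y\<close>. Monotonicity of \<open>J\<close> makes \<open>Y\<close> the maximum of a
  constant and the two variables with finite moments.\<close>

lemma last_exit_moment_finite:
  assumes div: "positively_divergent M \<xi> \<eta>" and p: "p > 0"
    and J\<xi>: "(\<integral>\<^sup>+\<omega>. ennreal (J_plus M (\<xi> 0) (max (- \<xi> 0 \<omega>) 0) powr (p + 1)) \<partial>M) < \<infinity>"
    and J\<eta>: "(\<integral>\<^sup>+\<omega>. ennreal (J_plus M (\<xi> 0) (max (- \<eta> 0 \<omega>) 0) powr (p + 1)) \<partial>M) < \<infinity>"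
  shows "(\<integral>\<^sup>+\<omega>. ennreal_powr (last_exit \<xi> \<eta> x \<omega>) p \<partial>M) < \<infinity>"
proof -
  have tm: "truncated_mean M (\<xi> 0)" by (rule truncated_mean_xi[OF walk_diverges[OF div]])
  interpret tm: truncated_mean M "\<xi> 0" by (rule tm)
  have int: "integrable M (\<lambda>\<omega>. tm.J (max (- \<xi> 0 \<omega>) 0))"
  proof (rule integrableI_nonneg)
    show "AE \<omega> in M. 0 \<le> tm.J (max (- \<xi> 0 \<omega>) 0)"
      by (auto intro!: AE_I2 order_trans[OF zero_le_one tm.J_ge_1])
    \<comment> \<open>As \<open>J \<ge> 1\<close>, the moment of order \<open>p + 1\<close> contains
      the first moment on which the drift estimate relies.\<close>
    have "z \<le> z powr (p + 1)" if "1 \<le> z" for z :: real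
      using powr_mono[of 1 "p + 1" z] that p by simp
    from this[OF tm.J_ge_1] have "(\<integral>\<^sup>+\<omega>. ennreal (tm.J (max (- \<xi> 0 \<omega>) 0)) \<partial>M) \<le> (\<integral>\<^sup>+\<omega>. ennreal (tm.J (max (- \<xi> 0 \<omega>) 0) powr (p + 1)) \<partial>M)"
      by (intro nn_integral_mono ennreal_leI) simp
    then show "(\<integral>\<^sup>+\<omega>. ennreal (tm.J (max (- \<xi> 0 \<omega>) 0)) \<partial>M) < \<infinity>" using J\<xi> by (rule le_less_trans)
  qed measurable
  obtain \<kappa> b0 where \<kappa>: "0 < \<kappa>" "\<kappa> \<le> 1" and b0: "0 < b0"
    and neg: "\<And>b. b \<ge> b0 \<Longrightarrow> expectation (\<lambda>\<omega>. min (max (- \<xi> 0 \<omega>) 0) b) \<le> (1 - \<kappa>) * tm.A b"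
    using tm.truncated_negative_part_le[OF int expectation_xi_pos[OF walk_diverges[OF div]]] by blast
  define \<theta> c0 where "\<theta> = \<kappa> / 4" and "c0 = \<kappa>\<^sup>2 / 8"
  have \<theta>: "0 < \<theta>" and c0: "0 < c0" using \<kappa> by (auto simp: \<theta>_def c0_def)
  have laplace: "expectation (\<lambda>\<omega>. exp (- (\<theta> * clamp_real b (\<xi> 0 \<omega>) / b))) \<le> exp (- (c0 / tm.J b))"
    if "b0 \<le> b" for b
    unfolding \<theta>_def c0_def using that b0 by (intro tm.truncated_laplace_le \<kappa> neg) auto
  have "0 < p + 1" using p by simp
  from dyadic_exp_sum_le[OF this c0] obtain C where C: "C \<ge> 0"
    "\<And>y. 1 \<le> y \<Longrightarrow> (\<Sum>j. ennreal ((2 ^ j) powr (p + 1) * exp (- (c0 * 2 ^ j / y)))) \<le> ennreal (C * y powr (p + 1))"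
    by auto
  define Y where "Y = (\<lambda>\<omega>. tm.J (jump b0 (X 0 \<omega>)))"
  have Y1: "1 \<le> Y \<omega>" for \<omega> unfolding Y_def using b0 by (intro tm.J_ge_1) (auto simp: jump_def)
  have Ymax: "Y \<omega> = max (tm.J b0) (max (tm.J (max (- \<xi> 0 \<omega>) 0)) (tm.J (max (- \<eta> 0 \<omega>) 0)))" for \<omega>
    unfolding Y_def jump_def using b0 by (simp add: tm.J_max)
  have [measurable]: "Y \<in> borel_measurable M" unfolding Ymax by measurable
  define K where "K = exp (2 * c0 + \<theta> * (2 + \<bar>x\<bar> / b0))"
  have "(\<integral>\<^sup>+\<omega>. ennreal_powr (last_exit \<xi> \<eta> x \<omega>) p \<partial>M)
    \<le> (\<Sum>j. ennreal ((2 ^ Suc j) powr p)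
        * emeasure M {\<omega> \<in> space M. \<exists>n\<in>{2 ^ j..<2 ^ Suc j}. perturbed_walk \<xi> \<eta> n \<omega> \<le> x})"
    by (rule last_exit_moment_le[OF div p])
  also have "\<dots> \<le> (\<Sum>j. ennreal (2 powr (p + 1) * K) * (\<integral>\<^sup>+\<omega>. ennreal ((2 ^ j) powr (p + 1) * exp (- (c0 * 2 ^ j / Y \<omega>))) \<partial>M))"
  proof (intro suminf_le summableI)
    fix j :: nat
    have "ennreal ((2 ^ Suc j) powr p) * emeasure M {\<omega> \<in> space M. \<exists>n\<in>{2 ^ j..<2 ^ Suc j}. perturbed_walk \<xi> \<eta> n \<omega> \<le> x}
      \<le> ennreal ((2 ^ Suc j) powr p) * (ennreal (2 * 2 ^ j * K) * (\<integral>\<^sup>+\<omega>. ennreal (exp (- (c0 * 2 ^ j / Y \<omega>))) \<partial>M))"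
      using prob_block_le[OF tm \<theta> b0 c0 laplace, of "2 ^ j" x]
      by (intro mult_left_mono) (simp_all add: K_def Y_def)
    also have "\<dots> = ennreal ((2 ^ Suc j) powr p * (2 * 2 ^ j * K)) * (\<integral>\<^sup>+\<omega>. ennreal (exp (- (c0 * 2 ^ j / Y \<omega>))) \<partial>M)"
      by (simp add: mult.assoc[symmetric] ennreal_mult[symmetric] K_def)
    \<comment> \<open>The block length \<open>2 ^ j\<close> joins the weight of order
      \<open>p\<close>.\<close>
    also have "(2 ^ Suc j) powr p * (2 * 2 ^ j * K) = 2 powr (p + 1) * K * (2 ^ j) powr (p + 1)"
      by (simp add: powr_mult powr_add mult_ac)
    also have "ennreal (2 powr (p + 1) * K * (2 ^ j) powr (p + 1)) * (\<integral>\<^sup>+\<omega>. ennreal (exp (- (c0 * 2 ^ j / Y \<omega>))) \<partial>M)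
        = ennreal (2 powr (p + 1) * K) * (\<integral>\<^sup>+\<omega>. ennreal ((2 ^ j) powr (p + 1) * exp (- (c0 * 2 ^ j / Y \<omega>))) \<partial>M)"
    proof -
      have "(\<integral>\<^sup>+\<omega>. ennreal ((2 ^ j) powr (p + 1) * exp (- (c0 * 2 ^ j / Y \<omega>))) \<partial>M)
          = ennreal ((2 ^ j) powr (p + 1)) * (\<integral>\<^sup>+\<omega>. ennreal (exp (- (c0 * 2 ^ j / Y \<omega>))) \<partial>M)"
        by (subst nn_integral_cmult[symmetric]) (auto simp: ennreal_mult[symmetric])
      then show ?thesis by (simp add: ennreal_mult mult.assoc K_def)
    qed
    finally show "ennreal ((2 ^ Suc j) powr p) * emeasure M {\<omega> \<in> space M. \<exists>n\<in>{2 ^ j..<2 ^ Suc j}. perturbed_walk \<xi> \<eta> n \<omega> \<le> x}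
      \<le> ennreal (2 powr (p + 1) * K) * (\<integral>\<^sup>+\<omega>. ennreal ((2 ^ j) powr (p + 1) * exp (- (c0 * 2 ^ j / Y \<omega>))) \<partial>M)" .
  qed
  also have "\<dots> = ennreal (2 powr (p + 1) * K) * (\<integral>\<^sup>+\<omega>. (\<Sum>j. ennreal ((2 ^ j) powr (p + 1) * exp (- (c0 * 2 ^ j / Y \<omega>)))) \<partial>M)"
    by (subst nn_integral_suminf) (auto simp: ennreal_suminf_cmult)
  also have "\<dots> \<le> ennreal (2 powr (p + 1) * K) * (\<integral>\<^sup>+\<omega>. ennreal C * (ennreal (tm.J b0 powr (p + 1))
      + (ennreal (tm.J (max (- \<xi> 0 \<omega>) 0) powr (p + 1)) + ennreal (tm.J (max (- \<eta> 0 \<omega>) 0) powr (p + 1)))) \<partial>M)"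
  proof (intro mult_left_mono nn_integral_mono)
    fix \<omega>
    have "(\<Sum>j. ennreal ((2 ^ j) powr (p + 1) * exp (- (c0 * 2 ^ j / Y \<omega>)))) \<le> ennreal C * ennreal (Y \<omega> powr (p + 1))"
      using C(2)[OF Y1] C(1) by (simp add: ennreal_mult)
    also have "\<dots> \<le> ennreal C * (ennreal (tm.J b0 powr (p + 1))
      + (ennreal (tm.J (max (- \<xi> 0 \<omega>) 0) powr (p + 1)) + ennreal (tm.J (max (- \<eta> 0 \<omega>) 0) powr (p + 1))))"
      unfolding Ymax by (intro mult_left_mono) (auto simp: max_def add_increasing add_increasing2)
    finally show "(\<Sum>j. ennreal ((2 ^ j) powr (p + 1) * exp (- (c0 * 2 ^ j / Y \<omega>)))) \<le> \<dots>" .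
  qed simp
  also have "\<dots> < \<infinity>"
    using J\<xi> J\<eta> by (simp add: nn_integral_cmult nn_integral_add emeasure_space_1 ennreal_mult_less_top)
  finally show ?thesis .
qed

end

text \<open>The necessity implications start from one level and end in conditions free of levels;
  the sufficiency implications lead from these to every level. Hence the versions for some and for
  all levels coincide.\<close>

theorem theorem2p10:
  fixes M :: "'a measure" and \<xi> \<eta> :: "nat \<Rightarrow> 'a \<Rightarrow> real" and p :: real
  assumes "perturbed_random_walk M \<xi> \<eta>"
    and "positively_divergent M \<xi> \<eta>"
    and "p > 0"
  defines "rho_fin \<equiv> \<lambda>x. (\<integral>\<^sup>+\<omega>. ennreal_powr (last_exit \<xi> \<eta> x \<omega>) p \<partial>M) < \<infinity>"
    and "rho_star_fin \<equiv> \<lambda>y. (\<integral>\<^sup>+\<omega>. ennreal_powr (last_exit_walk \<xi> y \<omega>) p \<partial>M) < \<infinity>"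
    and "J_fin \<equiv> \<lambda>Z :: 'a \<Rightarrow> real.
           (\<integral>\<^sup>+\<omega>. ennreal (J_plus M (\<xi> 0) (max (- Z \<omega>) 0) powr (p + 1)) \<partial>M) < \<infinity>"
  shows "((\<exists>x. rho_fin x) \<longleftrightarrow> (\<forall>x. rho_fin x))
       \<and> ((\<forall>x. rho_fin x) \<longleftrightarrow> (\<exists>y\<ge>0. rho_star_fin y) \<and> J_fin (\<eta> 0))
       \<and> ((\<exists>y\<ge>0. rho_star_fin y) \<and> J_fin (\<eta> 0) \<longleftrightarrow> (\<forall>y\<ge>0. rho_star_fin y) \<and> J_fin (\<eta> 0))
       \<and> ((\<forall>y\<ge>0. rho_star_fin y) \<and> J_fin (\<eta> 0) \<longleftrightarrow> J_fin (\<xi> 0) \<and> J_fin (\<eta> 0))"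
proof -
  interpret perturbed_random_walk M \<xi> \<eta> by (rule assms(1))
  interpret S: perturbed_random_walk M \<xi> \<xi> by (rule self_perturbed)
  note div = assms(2) and p = assms(3)
  have divS: "positively_divergent M \<xi> \<xi>" by (rule self_diverges[OF walk_diverges[OF div]])
  have \<xi>_of_tail: "J_fin (\<xi> 0)" if "dyadic_tail_sum (walk \<xi>) p y < \<infinity>" for y
    using S.J_moment_finite[OF divS p] that unfolding J_fin_def dyadic_tail_sum_self by blast
  have rho: "J_fin (\<xi> 0)" "J_fin (\<eta> 0)" if "rho_fin x" for x
  proof -
    have fin: "dyadic_tail_sum (perturbed_walk \<xi> \<eta>) p x < \<infinity>"
      using that unfolding rho_fin_def by (rule dyadic_tail_sum_finite[OF div p])
    show "J_fin (\<eta> 0)" unfolding J_fin_def by (rule J_moment_finite[OF div p fin])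
    show "J_fin (\<xi> 0)" using dyadic_tail_sum_walk_finite[OF fin] \<xi>_of_tail by blast
  qed
  have rho_star: "J_fin (\<xi> 0)" if "rho_star_fin y" for y
    using S.dyadic_tail_sum_finite[OF divS p] that \<xi>_of_tail
    unfolding rho_star_fin_def last_exit_walk_eq dyadic_tail_sum_self by blast
  have "rho_fin x" if "J_fin (\<xi> 0)" "J_fin (\<eta> 0)" for x
    using last_exit_moment_finite[OF div p] that unfolding rho_fin_def J_fin_def by blast
  moreover have "rho_star_fin y" if "J_fin (\<xi> 0)" for y
    using S.last_exit_moment_finite[OF divS p] that
    unfolding rho_star_fin_def J_fin_def last_exit_walk_eq by blast
  \<comment> \<open>A witness for passing from all \<open>y \<ge> 0\<close> to some
    \<open>y \<ge> 0\<close>.\<close>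
  moreover have "(0::real) \<le> 0" by simp
  ultimately show ?thesis using rho rho_star by blast
qed

end
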